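(* Let $S$ be a finitely generated cancellative hyperbolic semigroup such that its geodesic boundary (identified with its quasi-geodesic boundary $\partial S$) is a $T_1$ space with respect to either $\mathcal O_f$ or $\mathcal O_b$. Then $|\partial S|\in\{0,1,2,\infty\}$.
   Context: The (right) Cayley digraph of a semigroup $S$ with respect to a finite generating set $A$ has vertex set $S$ and an edge from $x$ to $xa$ for all $x\in S$, $a\in A$. A finitely generated semigroup is hyperbolic if its Cayley digraph with respect to some finite generating set is hyperbolic in the sense below. For right cancellative finitely generated semigroups, hyperbolicity and the (order and homeomorphism type of the) boundary do not depend on the chosen finite generating set. $\partial S$ denotes the quasi-geodesic boundary $\partial D$ of the Cayley digraph $D$ of $S$ with respect to a finite generating set. For such $D$ every quasi-geodesic boundary point contains exactly one geodesic boundary point (class of geodesic rays and anti-rays), and the two boundaries are identified this way. In a digraph $D$, a directed path is a sequence $x_0\ldots x_n$ of vertices with every $x_ix_{i+1}$ an edge; its length $\ell$ is $n$. $d(x,y)$ is the length of a shortest directed path from $x$ to $y$, or $\infty$ if there is none. A directed path from $x$ to $y$ is a geodesic if its length is $d(x,y)$. $\mathcal B^+_r(x)=\{y: d(x,y)\le r\}$, $\mathcal B^-_r(x)=\{y:d(y,x)\le r\}$, and $\mathcal B^\pm_r(Y)=\bigcup_{y\in Y}\mathcal B^\pm_r(y)$. A geodesic triangle consists of three points and three geodesics (its sides), one between every two of these points (in one of the two directions). It is $\delta$-thin if for every labelling $P,Q,R$ of its sides such that the starting point of $P$ is the starting or the end point of $Q$ and the end point of $P$ is the starting or the end point of $R$,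 we have $P\subseteq\mathcal B^+_\delta(Q)\cup\mathcal B^-_\delta(R)$. $D$ is hyperbolic if for some $\delta\ge0$ all geodesic triangles are $\delta$-thin. A ray is a sequence $x_0x_1\ldots$ of distinct vertices with edges $x_ix_{i+1}$; an anti-ray is such a sequence with edges $x_{i+1}x_i$. A directed path $P$ is a $(\gamma,c)$-quasi-geodesic if $\ell(uPv)\le\gamma d(u,v)+c$ for every directed subpath $uPv$ of $P$; a (anti-)ray is quasi-geodesic if for some $\gamma\ge1,c\ge0$ all its finite directed subpaths are $(\gamma,c)$-quasi-geodesics. For quasi-geodesic rays or anti-rays write $R_1\le R_2$ if there is $M\ge0$ such that for every $r\ge0$ and every vertex $x$ there is a directed path from $R_1$ to $R_2$ of length at most $M$ outside of $\mathcal B^+_r(x)\cup\mathcal B^-_r(x)$; $R_1\approx R_2$ means $R_1\le R_2\le R_1$, an equivalence relation in this setting. $\partial D$ is the set of its classes, ordered by the order induced by $\le$. Every $\mu\in\partial D$ is the union of a set $\mu_1$ of rays and a set $\mu_2$ of anti-rays (one of them possibly empty). Topologies $\mathcal O_f,\mathcal O_b$ on $V(D)\cup\partial D$ (and, by restriction, on $\partial D$). For $\mu\in\partial D$, a vertex $x$ and $r\ge0$ let $C^-(\mu,x,r)$ be the set of vertices $y$ for which there is $R\in\mu_1$ such that for all $z$ on $R$ there is a $y$-$z$ geodesic outside of $\mathcal B^+_r(x)\cup\mathcal B^-_r(x)$; let $C^+(\mu,x,r)$ be the set of vertices $y$ for which there is $R\in\mu_2$ such that for all $z$ on $R$ there is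 a $z$-$y$ geodesic outside of $\mathcal B^+_r(x)\cup\mathcal B^-_r(x)$. $\mu'\in\partial D$ lives in such a set if some element of $\mu'$ lies in it. $C^\pm_\partial(\mu,x,r)$ is $C^\pm(\mu,x,r)$ together with all boundary points living in it and with $\mu$ itself. Put $C^f_\partial(\omega,x,r)=\bigcup_{\omega\le\mu}C^+_\partial(\mu,x,r)$ and $C^b_\partial(\omega,x,r)=\bigcup_{\mu\le\omega}C^-_\partial(\mu,x,r)$. $\mathcal O_f$ is generated by all $C^f_\partial(\omega,x,r)$ and all $\{y: d(x,y)<r\}$; $\mathcal O_b$ is generated by all $C^b_\partial(\omega,x,r)$ and all $\{y: d(y,x)<r\}$. *)

theory Defs
  imports "HOL-Analysis.Analysis"
begin

section \<open>Digraphs\<close>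

text \<open>
  A digraph is given by its edge relation; its vertex set is the whole type.  Distances are
  integers or infinite, so natural numbers suffice for all radii and thinness constants.
\<close>

definition dpath :: "'a rel \<Rightarrow> 'a list \<Rightarrow> bool" where
  "dpath E p \<longleftrightarrow> p \<noteq> [] \<and> successively (\<lambda>x y. (x, y) \<in> E) p"

definition dpath_betw :: "'a rel \<Rightarrow> 'a \<Rightarrow> 'a list \<Rightarrow> 'a \<Rightarrow> bool" where
  "dpath_betw E x p y \<longleftrightarrow> dpath E p \<and> hd p = x \<and> last p = y"

definition plen :: "'a list \<Rightarrow> nat" where
  "plen p = length p - 1"

text \<open>The infimum of the empty set is \<open>\<infinity>\<close>.\<close>

definition ddist :: "'a rel \<Rightarrow> 'a \<Rightarrow> 'a \<Rightarrow> enat" where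
  "ddist E x y = (INF p \<in> {p. dpath_betw E x p y}. enat (plen p))"

definition geodesic_betw :: "'a rel \<Rightarrow> 'a \<Rightarrow> 'a list \<Rightarrow> 'a \<Rightarrow> bool" where
  "geodesic_betw E x p y \<longleftrightarrow> dpath_betw E x p y \<and> enat (plen p) = ddist E x y"

definition out_ball :: "'a rel \<Rightarrow> nat \<Rightarrow> 'a \<Rightarrow> 'a set" where
  "out_ball E r x = {y. ddist E x y \<le> enat r}"

definition in_ball :: "'a rel \<Rightarrow> nat \<Rightarrow> 'a \<Rightarrow> 'a set" where
  "in_ball E r x = {y. ddist E y x \<le> enat r}"

definition avoids_balls :: "'a rel \<Rightarrow> nat \<Rightarrow> 'a \<Rightarrow> 'a list \<Rightarrow> bool" where
  "avoids_balls E r x p \<longleftrightarrow> set p \<inter> (out_ball E r x \<union> in_ball E r x) = {}"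


section \<open>Hyperbolicity\<close>

definition geodesic_side :: "'a rel \<Rightarrow> 'a \<Rightarrow> 'a \<Rightarrow> 'a list \<Rightarrow> bool" where
  "geodesic_side E x y p \<longleftrightarrow> geodesic_betw E x p y \<or> geodesic_betw E y p x"

definition geodesic_triangle :: "'a rel \<Rightarrow> 'a list \<Rightarrow> 'a list \<Rightarrow> 'a list \<Rightarrow> bool" where
  "geodesic_triangle E s1 s2 s3 \<longleftrightarrow>
     (\<exists>x y z. geodesic_side E x y s1 \<and> geodesic_side E y z s2 \<and> geodesic_side E z x s3)"

text \<open>The multiset equation says that \<open>P, Q, R\<close> is a labelling of the three sides.\<close>

definition thin_triangle ::
  "'a rel \<Rightarrow> nat \<Rightarrow> 'a list \<Rightarrow> 'a list \<Rightarrow> 'a list \<Rightarrow> bool" where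
  "thin_triangle E \<delta> s1 s2 s3 \<longleftrightarrow>
     (\<forall>P Q R. {#P, Q, R#} = {#s1, s2, s3#} \<longrightarrow>
        hd P \<in> {hd Q, last Q} \<longrightarrow> last P \<in> {hd R, last R} \<longrightarrow>
        set P \<subseteq> (\<Union>q \<in> set Q. out_ball E \<delta> q) \<union> (\<Union>q \<in> set R. in_ball E \<delta> q))"

definition hyperbolic_digraph :: "'a rel \<Rightarrow> bool" where
  "hyperbolic_digraph E \<longleftrightarrow>
     (\<exists>\<delta>. \<forall>s1 s2 s3. geodesic_triangle E s1 s2 s3 \<longrightarrow> thin_triangle E \<delta> s1 s2 s3)"


section \<open>The quasi-geodesic boundary\<close>

definition quasi_geodesic :: "'a rel \<Rightarrow> real \<Rightarrow> real \<Rightarrow> 'a list \<Rightarrow> bool" where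
  "quasi_geodesic E \<gamma> c p \<longleftrightarrow> dpath E p \<and>
     (\<forall>i j. i \<le> j \<longrightarrow> j < length p \<longrightarrow>
        ereal (real (j - i)) \<le> ereal \<gamma> * ereal_of_enat (ddist E (p ! i) (p ! j)) + ereal c)"

definition ray :: "'a rel \<Rightarrow> (nat \<Rightarrow> 'a) \<Rightarrow> bool" where
  "ray E R \<longleftrightarrow> inj R \<and> (\<forall>i. (R i, R (Suc i)) \<in> E)"

definition antiray :: "'a rel \<Rightarrow> (nat \<Rightarrow> 'a) \<Rightarrow> bool" where
  "antiray E R \<longleftrightarrow> inj R \<and> (\<forall>i. (R (Suc i), R i) \<in> E)"

definition qg_ray :: "'a rel \<Rightarrow> (nat \<Rightarrow> 'a) \<Rightarrow> bool" where
  "qg_ray E R \<longleftrightarrow> ray E R \<and>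
     (\<exists>\<gamma>\<ge>1. \<exists>c\<ge>0. \<forall>i j. i \<le> j \<longrightarrow> quasi_geodesic E \<gamma> c (map R [i..<Suc j]))"

definition qg_antiray :: "'a rel \<Rightarrow> (nat \<Rightarrow> 'a) \<Rightarrow> bool" where
  "qg_antiray E R \<longleftrightarrow> antiray E R \<and>
     (\<exists>\<gamma>\<ge>1. \<exists>c\<ge>0. \<forall>i j. i \<le> j \<longrightarrow> quasi_geodesic E \<gamma> c (rev (map R [i..<Suc j])))"

definition ray_le :: "'a rel \<Rightarrow> (nat \<Rightarrow> 'a) \<Rightarrow> (nat \<Rightarrow> 'a) \<Rightarrow> bool" where
  "ray_le E R1 R2 \<longleftrightarrow>
     (\<exists>M. \<forall>r x. \<exists>p. dpath E p \<and> hd p \<in> range R1 \<and> last p \<in> range R2 \<and>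
        plen p \<le> M \<and> avoids_balls E r x p)"

definition ray_equiv :: "'a rel \<Rightarrow> (nat \<Rightarrow> 'a) rel" where
  "ray_equiv E = {(R1, R2). R1 \<in> Collect (qg_ray E) \<union> Collect (qg_antiray E) \<and>
     R2 \<in> Collect (qg_ray E) \<union> Collect (qg_antiray E) \<and> ray_le E R1 R2 \<and> ray_le E R2 R1}"

type_synonym 'a bpoint = "(nat \<Rightarrow> 'a) set"

definition qg_boundary :: "'a rel \<Rightarrow> 'a bpoint set" where
  "qg_boundary E = (Collect (qg_ray E) \<union> Collect (qg_antiray E)) // ray_equiv E"

definition boundary_le :: "'a rel \<Rightarrow> 'a bpoint \<Rightarrow> 'a bpoint \<Rightarrow> bool" where
  "boundary_le E \<mu> \<nu> \<longleftrightarrow> (\<exists>R\<in>\<mu>. \<exists>Q\<in>\<nu>. ray_le E R Q)"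


section \<open>The two topologies\<close>

text \<open>
  The space consisting of the vertices and the boundary points is a disjoint sum: \<open>Inl\<close> injects
  vertices, \<open>Inr\<close> injects boundary points.  If edges in both directions are present, one sequence
  may be both a ray and an anti-ray, but quasi-geodesic in one direction only; hence the rays
  and anti-rays of a class are selected by \<^const>\<open>qg_ray\<close> and \<^const>\<open>qg_antiray\<close>.
\<close>

definition C_minus :: "'a rel \<Rightarrow> 'a bpoint \<Rightarrow> 'a \<Rightarrow> nat \<Rightarrow> 'a set" where
  "C_minus E \<mu> x r = {y. \<exists>R\<in>\<mu>. qg_ray E R \<and>
     (\<forall>z\<in>range R. \<exists>p. geodesic_betw E y p z \<and> avoids_balls E r x p)}"

definition C_plus :: "'a rel \<Rightarrow> 'a bpoint \<Rightarrow> 'a \<Rightarrow> nat \<Rightarrow> 'a set" where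
  "C_plus E \<mu> x r = {y. \<exists>R\<in>\<mu>. qg_antiray E R \<and>
     (\<forall>z\<in>range R. \<exists>p. geodesic_betw E z p y \<and> avoids_balls E r x p)}"

definition lives_in :: "'a bpoint \<Rightarrow> 'a set \<Rightarrow> bool" where
  "lives_in \<mu> C \<longleftrightarrow> (\<exists>R\<in>\<mu>. range R \<subseteq> C)"

definition with_boundary :: "'a rel \<Rightarrow> 'a bpoint \<Rightarrow> 'a set \<Rightarrow> ('a + 'a bpoint) set" where
  "with_boundary E \<mu> C = Inl ` C \<union> Inr ` ({\<mu>' \<in> qg_boundary E. lives_in \<mu>' C} \<union> {\<mu>})"

definition Cf_nbhd :: "'a rel \<Rightarrow> 'a bpoint \<Rightarrow> 'a \<Rightarrow> nat \<Rightarrow> ('a + 'a bpoint) set" where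
  "Cf_nbhd E \<omega> x r =
     (\<Union>\<mu> \<in> {\<mu> \<in> qg_boundary E. boundary_le E \<omega> \<mu>}. with_boundary E \<mu> (C_plus E \<mu> x r))"

definition Cb_nbhd :: "'a rel \<Rightarrow> 'a bpoint \<Rightarrow> 'a \<Rightarrow> nat \<Rightarrow> ('a + 'a bpoint) set" where
  "Cb_nbhd E \<omega> x r =
     (\<Union>\<mu> \<in> {\<mu> \<in> qg_boundary E. boundary_le E \<mu> \<omega>}. with_boundary E \<mu> (C_minus E \<mu> x r))"

definition forward_topology :: "'a rel \<Rightarrow> ('a + 'a bpoint) topology" where
  "forward_topology E = topology_generated_by
     ({Cf_nbhd E \<omega> x r |\<omega> x r. \<omega> \<in> qg_boundary E} \<union>
      {Inl ` {y. ddist E x y < enat r} |x r. True})"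

definition backward_topology :: "'a rel \<Rightarrow> ('a + 'a bpoint) topology" where
  "backward_topology E = topology_generated_by
     ({Cb_nbhd E \<omega> x r |\<omega> x r. \<omega> \<in> qg_boundary E} \<union>
      {Inl ` {y. ddist E y x < enat r} |x r. True})"


section \<open>Semigroups\<close>

inductive_set generated_subsemigroup :: "'a::semigroup_mult set \<Rightarrow> 'a set" for A where
  base: "a \<in> A \<Longrightarrow> a \<in> generated_subsemigroup A"
| mult: "x \<in> generated_subsemigroup A \<Longrightarrow> y \<in> generated_subsemigroup A \<Longrightarrow>
    x * y \<in> generated_subsemigroup A"

definition finite_generating_set :: "'a::semigroup_mult set \<Rightarrow> bool" where
  "finite_generating_set A \<longleftrightarrow> finite A \<and> generated_subsemigroup A = UNIV"

definition cayley_digraph :: "'a::semigroup_mult set \<Rightarrow> 'a rel" where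
  "cayley_digraph A = {(x, x * a) |x a. a \<in> A}"

definition hyperbolic_semigroup :: "'a::semigroup_mult itself \<Rightarrow> bool" where
  "hyperbolic_semigroup _ \<longleftrightarrow>
     (\<exists>A :: 'a set. finite_generating_set A \<and> hyperbolic_digraph (cayley_digraph A))"

end

theory Submission
  imports Defs
begin

text \<open>
  Suppose that the boundary is finite; the claim is that it has at most two points.

  Left cancellation makes every left translation an isometric embedding of the Cayley digraph, so
  the semigroup acts on classes of rays.  As there are only finitely many classes, the powers of an
  element \<open>c\<close> cannot all move a given ray to different classes, and after cancellation the ray is
  equivalent to its translate by some power of \<open>c\<close> (\<open>translate_recurs\<close>).  This translate lies
  in the right ideal of \<open>c\<close>.  Hence from every vertex there are directed paths to every given ray.

  If some element has infinitely many left divisors, then this recurrence closes cycles and shows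
  that the semigroup is a group (\<open>group_if_infinitely_many_left_divisors\<close>).  An infinite group
  contains a geodesic line, and up to a bounded error every element translates the line to one with the
  same ends.  As triangles are thin, the centre of such a translate is close to the line, so the group is a
  bounded neighbourhood of a line (\<open>group_near_line\<close>) and has two ends.

  If all elements have only finitely many left divisors, then directed detours are bounded: a vertex
  that lies on some directed path from \<open>x\<close> to a nearby vertex \<open>y\<close> is close to both
  (\<open>intermediate_points_close\<close>).  With this, thin triangles and recurrence
  show that a single geodesic ray passes, in both directions, close to everything that is reachable
  from its origin (\<open>geodesic_ray_tracks_all\<close>).  Consequently all rays are equivalent.

  The boundary belongs to the given generating set \<open>A\<close>, while triangles may be thin only for another
  generating set \<open>B\<close>.  All geodesics are therefore taken with respect to \<open>B\<close>, and the rays of the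
  boundary enter only through the relation \<open>coarse_le\<close>, which is the same for \<open>A\<close> and \<open>B\<close>
  (\<open>coarse_le_A_iff\<close>).  Conversely, a sequence that is a quasi-geodesic up to bounded jumps
  represents a boundary point for either generating set (\<open>coarse_ray_near_qg_ray\<close>).
\<close>

section \<open>Distances and geodesics\<close>

definition near :: "'a rel \<Rightarrow> nat \<Rightarrow> 'a \<Rightarrow> 'a \<Rightarrow> bool" where
  "near E n x y \<longleftrightarrow> ddist E x y \<le> enat n"

lemma walk_iff_relpow:
  "(\<exists>p. dpath_betw E x p y \<and> plen p = n) \<longleftrightarrow> (x, y) \<in> E ^^ n"
proof
  assume "\<exists>p. dpath_betw E x p y \<and> plen p = n"
  then obtain p where p: "p \<noteq> []" "successively (\<lambda>x y. (x, y) \<in> E) p" "hd p = x" "last p = y"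
    "length p = Suc n"
    by (auto simp: dpath_betw_def dpath_def plen_def)
  have "\<forall>i<n. (p ! i, p ! Suc i) \<in> E"
    using p(2,5) by (simp add: successively_conv_nth)
  moreover have "p ! 0 = x" "p ! n = y"
    using p by (auto simp: hd_conv_nth last_conv_nth)
  ultimately show "(x, y) \<in> E ^^ n"
    unfolding relpow_fun_conv by blast
next
  assume "(x, y) \<in> E ^^ n"
  then obtain f where f: "f 0 = x" "f n = y" "\<forall>i<n. (f i, f (Suc i)) \<in> E"
    unfolding relpow_fun_conv by blast
  have "dpath_betw E x (map f [0..<Suc n]) y"
    using f by (auto simp: dpath_betw_def dpath_def successively_conv_nth hd_map last_map
        simp del: upt_Suc)
  then show "\<exists>p. dpath_betw E x p y \<and> plen p = n"
    by (intro exI[of _ "map f [0..<Suc n]"]) (simp add: plen_def)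
qed

lemma near_iff_relpow: "near E n x y \<longleftrightarrow> (\<exists>k\<le>n. (x, y) \<in> E ^^ k)"
proof
  assume n: "near E n x y"
  let ?S = "(\<lambda>p. enat (plen p)) ` {p. dpath_betw E x p y}"
  have "?S \<noteq> {}"
  proof
    assume "?S = {}"
    then have "ddist E x y = \<infinity>" by (simp add: ddist_def top_enat_def)
    with n show False by (simp add: near_def)
  qed
  then have "ddist E x y \<in> ?S"
    unfolding ddist_def by (simp add: Inf_enat_def) (metis (mono_tags, lifting) LeastI_ex imageI mem_Collect_eq)
  then obtain p where "dpath_betw E x p y" "ddist E x y = enat (plen p)" by auto
  with n show "\<exists>k\<le>n. (x, y) \<in> E ^^ k"
    unfolding near_def by (intro exI[of _ "plen p"]) (auto simp: walk_iff_relpow[symmetric])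
next
  assume "\<exists>k\<le>n. (x, y) \<in> E ^^ k"
  then obtain p where "dpath_betw E x p y" "plen p \<le> n"
    by (auto simp: walk_iff_relpow[symmetric])
  then have "ddist E x y \<le> enat (plen p)"
    unfolding ddist_def by (intro INF_lower) auto
  with \<open>plen p \<le> n\<close> show "near E n x y"
    unfolding near_def by (metis enat_ord_simps(1) order_trans)
qed

lemma near_refl [simp]: "near E n x x"
  unfolding near_iff_relpow by (intro exI[of _ 0]) auto

lemma near_mono: "near E m x y \<Longrightarrow> m \<le> n \<Longrightarrow> near E n x y"
  unfolding near_iff_relpow by (meson order_trans)

lemma near_trans: "near E m x y \<Longrightarrow> near E n y z \<Longrightarrow> near E (m + n) x z"
  unfolding near_iff_relpow by (meson add_mono relpow_trans)

lemma near_0 [simp]: "near E 0 x y \<longleftrightarrow> x = y"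
  unfolding near_iff_relpow by auto

lemma near_edge: "(x, y) \<in> E \<Longrightarrow> near E 1 x y"
  unfolding near_iff_relpow by (intro exI[of _ 1]) auto

text \<open>
  Segments are parametrised by functions on the natural numbers, so that sides of triangles can be
  initial segments of rays, translates and stretches of lines without a conversion of lists.
\<close>

definition geodesic_segment :: "'a rel \<Rightarrow> (nat \<Rightarrow> 'a) \<Rightarrow> nat \<Rightarrow> bool" where
  "geodesic_segment E g n \<longleftrightarrow> (\<forall>i j m. i \<le> j \<longrightarrow> j \<le> n \<longrightarrow> (near E m (g i) (g j) \<longleftrightarrow> j - i \<le> m))"

lemma geodesic_segmentD: "geodesic_segment E g n \<Longrightarrow> i \<le> j \<Longrightarrow> j \<le> n \<Longrightarrow> near E m (g i) (g j) \<longleftrightarrow> j - i \<le> m"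
  unfolding geodesic_segment_def by blast

lemma near_chain:
  assumes "\<And>i. i < n \<Longrightarrow> near E 1 (f i) (f (Suc i))" "i \<le> j" "j \<le> n"
  shows "near E (j - i) (f i) (f j)"
  using assms(2,3)
proof (induction j)
  case (Suc j)
  show ?case
  proof (cases "i = Suc j")
    case False
    then have "near E (j - i) (f i) (f j)" "near E 1 (f j) (f (Suc j))"
      using Suc assms(1) by auto
    from near_trans[OF this] show ?thesis using False Suc.prems by (simp add: Suc_diff_le)
  qed simp
qed simp

lemma geodesic_exists:
  assumes "near E n x y"
  obtains g m where "m \<le> n" "geodesic_segment E g m" "g 0 = x" "g m = y"
proof -
  define m where "m = (LEAST k. near E k x y)"
  have m: "near E m x y" and least: "\<And>k. near E k x y \<Longrightarrow> m \<le> k"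
    unfolding m_def using assms by (auto intro: LeastI Least_le)
  from m obtain k where "k \<le> m" "(x, y) \<in> E ^^ k" unfolding near_iff_relpow by auto
  moreover from this have "k = m" using least[of k] unfolding near_iff_relpow by fastforce
  ultimately obtain f where f: "f 0 = x" "f m = y" "\<forall>i<m. (f i, f (Suc i)) \<in> E"
    unfolding relpow_fun_conv by blast
  have chain: "near E (j - i) (f i) (f j)" if "i \<le> j" "j \<le> m" for i j
    using near_chain[of m E f i j] that f(3) near_edge by metis
  have "geodesic_segment E f m"
    unfolding geodesic_segment_def
  proof (intro allI impI iffI)
    fix i j k assume ij: "i \<le> j" "j \<le> m" and "near E k (f i) (f j)"
    moreover have "near E i x (f i)" "near E (m - j) (f j) y"
      using chain[of 0 i] chain[of j m] ij f by auto
    ultimately have "near E (i + k + (m - j)) x y"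
      using near_trans by metis
    from least[OF this] ij show "j - i \<le> k" by linarith
  next
    fix i j k assume "i \<le> j" "j \<le> m" "j - i \<le> k"
    then show "near E k (f i) (f j)" using chain near_mono by metis
  qed
  with that[OF least[OF assms]] f show thesis by blast
qed

lemma geodesic_segment_imp_geodesic_betw:
  assumes "geodesic_segment E g n"
  shows "geodesic_betw E (g 0) (map g [0..<Suc n]) (g n)"
proof -
  have step: "(g i, g (Suc i)) \<in> E" if "i < n" for i
  proof -
    have "near E 1 (g i) (g (Suc i))" "\<not> near E 0 (g i) (g (Suc i))"
      using that by (simp_all add: geodesic_segmentD[OF assms, of i "Suc i"] del: near_0)
    then obtain k where "k \<le> 1" "(g i, g (Suc i)) \<in> E ^^ k" unfolding near_iff_relpow by auto
    moreover from this have "k \<noteq> 0" using \<open>\<not> near E 0 (g i) (g (Suc i))\<close> by (cases k) auto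
    ultimately show ?thesis by (cases k) auto
  qed
  have "near E m (g 0) (g n) \<longleftrightarrow> n \<le> m" for m using geodesic_segmentD[OF assms, of 0 n] by simp
  then have "ddist E (g 0) (g n) = enat n"
    unfolding near_def by (cases "ddist E (g 0) (g n)") (auto intro: antisym)
  with step show ?thesis
    by (auto simp: geodesic_betw_def dpath_betw_def dpath_def plen_def successively_conv_nth
        hd_map last_map simp del: upt_Suc)
qed

text \<open>
  In a digraph not all pairs of points are joined by a geodesic.  The triangles that occur below are
  those along \<open>x \<rightarrow> y \<rightarrow> z\<close>: \<open>f\<close> leads from \<open>x\<close> to \<open>y\<close>, \<open>g\<close> from \<open>y\<close> to \<open>z\<close>, and \<open>h\<close> from \<open>x\<close> to \<open>z\<close>.
  Each side is covered by an out-neighbourhood of the side at its starting point and an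
  in-neighbourhood of the side at its end point.
\<close>

definition thin_transitive :: "'a rel \<Rightarrow> nat \<Rightarrow> bool" where
  "thin_transitive E \<delta> \<longleftrightarrow> (\<forall>f l g m h n. geodesic_segment E f l \<longrightarrow> geodesic_segment E g m \<longrightarrow> geodesic_segment E h n \<longrightarrow>
     f 0 = h 0 \<longrightarrow> f l = g 0 \<longrightarrow> g m = h n \<longrightarrow>
       (\<forall>i\<le>n. (\<exists>j\<le>l. near E \<delta> (f j) (h i)) \<or> (\<exists>j\<le>m. near E \<delta> (h i) (g j))) \<and>
       (\<forall>i\<le>l. (\<exists>j\<le>n. near E \<delta> (h j) (f i)) \<or> (\<exists>j\<le>m. near E \<delta> (f i) (g j))) \<and>
       (\<forall>i\<le>m. (\<exists>j\<le>l. near E \<delta> (f j) (g i)) \<or> (\<exists>j\<le>n. near E \<delta> (g i) (h j))))"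

lemma hyperbolic_imp_thin_transitive:
  assumes "hyperbolic_digraph E"
  obtains \<delta> where "thin_transitive E \<delta>"
proof -
  from assms obtain \<delta> where \<delta>: "\<And>s1 s2 s3. geodesic_triangle E s1 s2 s3 \<Longrightarrow> thin_triangle E \<delta> s1 s2 s3"
    unfolding hyperbolic_digraph_def by blast
  have "thin_transitive E \<delta>"
    unfolding thin_transitive_def
  proof (intro allI impI)
    fix f l g m h n
    assume geo: "geodesic_segment E f l" "geodesic_segment E g m" "geodesic_segment E h n" and eq: "f 0 = h 0" "f l = g 0" "g m = h n"
    let ?p = "\<lambda>f l. map f [0..<Suc l]"
    have "geodesic_triangle E (?p f l) (?p g m) (?p h n)"
      unfolding geodesic_triangle_def geodesic_side_def
      using geo[THEN geodesic_segment_imp_geodesic_betw] eq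
      by (intro exI[of _ "f 0"] exI[of _ "g 0"] exI[of _ "g m"]) auto
    from \<delta>[OF this] have thin: "\<And>P Q R. {#P, Q, R#} = {#?p f l, ?p g m, ?p h n#} \<Longrightarrow>
        hd P \<in> {hd Q, last Q} \<Longrightarrow> last P \<in> {hd R, last R} \<Longrightarrow>
        set P \<subseteq> (\<Union>q \<in> set Q. out_ball E \<delta> q) \<union> (\<Union>q \<in> set R. in_ball E \<delta> q)"
      unfolding thin_triangle_def by blast
    have hd: "hd (?p k i) = k 0" and last: "last (?p k i) = k i" for k :: "nat \<Rightarrow> 'a" and i
      by (auto simp: hd_map last_map simp del: upt_Suc)
    have *: "\<forall>i\<le>c. (\<exists>j\<le>a. near E \<delta> (u j) (w i)) \<or> (\<exists>j\<le>b. near E \<delta> (w i) (v j))"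
      if "set (?p w c) \<subseteq> (\<Union>q \<in> set (?p u a). out_ball E \<delta> q) \<union> (\<Union>q \<in> set (?p v b). in_ball E \<delta> q)"
      for u v w :: "nat \<Rightarrow> 'a" and a b c
    proof (intro allI impI)
      fix i assume "i \<le> c"
      then have "w i \<in> set (?p w c)" by (auto simp del: upt_Suc)
      with that have "w i \<in> (\<Union>q \<in> set (?p u a). out_ball E \<delta> q) \<union> (\<Union>q \<in> set (?p v b). in_ball E \<delta> q)"
        by blast
      then show "(\<exists>j\<le>a. near E \<delta> (u j) (w i)) \<or> (\<exists>j\<le>b. near E \<delta> (w i) (v j))"
        unfolding out_ball_def in_ball_def near_def by (auto simp del: upt_Suc simp: less_Suc_eq_le)
    qed
    show "(\<forall>i\<le>n. (\<exists>j\<le>l. near E \<delta> (f j) (h i)) \<or> (\<exists>j\<le>m. near E \<delta> (h i) (g j))) \<and>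
       (\<forall>i\<le>l. (\<exists>j\<le>n. near E \<delta> (h j) (f i)) \<or> (\<exists>j\<le>m. near E \<delta> (f i) (g j))) \<and>
       (\<forall>i\<le>m. (\<exists>j\<le>l. near E \<delta> (f j) (g i)) \<or> (\<exists>j\<le>n. near E \<delta> (g i) (h j)))"
    proof (intro conjI)
      show "\<forall>i\<le>n. (\<exists>j\<le>l. near E \<delta> (f j) (h i)) \<or> (\<exists>j\<le>m. near E \<delta> (h i) (g j))"
        by (rule *, rule thin, simp add: add_mset_commute del: upt_Suc) (simp_all only: hd last eq, simp_all)
      show "\<forall>i\<le>l. (\<exists>j\<le>n. near E \<delta> (h j) (f i)) \<or> (\<exists>j\<le>m. near E \<delta> (f i) (g j))"
        by (rule *, rule thin, simp add: add_mset_commute del: upt_Suc) (simp_all only: hd last eq, simp_all)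
      show "\<forall>i\<le>m. (\<exists>j\<le>l. near E \<delta> (f j) (g i)) \<or> (\<exists>j\<le>n. near E \<delta> (g i) (h j))"
        by (rule *, rule thin, simp add: add_mset_commute del: upt_Suc) (simp_all only: hd last eq, simp_all)
    qed
  qed
  with that show thesis .
qed

section \<open>Compactness\<close>

text \<open>
  Compactness of a product of finite sets, by repeatedly passing to an infinite set of indices on
  which one further coordinate is constant.
\<close>

lemma pointwise_subsequence_limit:
  fixes f :: "nat \<Rightarrow> nat \<Rightarrow> 'b"
  assumes fin: "\<And>i. finite (range (\<lambda>n. f n i))" and "infinite J"
  obtains h where "\<And>N. infinite {n \<in> J. \<forall>i<N. f n i = h i}"
proof -
  have ex: "\<exists>b. infinite {n \<in> K. f n i = b}" if K: "infinite K" for K i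
  proof -
    have "finite ((\<lambda>n. f n i) ` K)" using fin[of i] by (rule finite_subset[rotated]) auto
    from pigeonhole_infinite[OF K this] obtain a where "infinite {n\<in>K. f n i = f a i}" by auto
    then show ?thesis by blast
  qed
  define nxt where "nxt K i = {n \<in> K. f n i = (SOME b. infinite {n \<in> K. f n i = b})}" for K i
  have nxt: "infinite (nxt K i)" if "infinite K" for K i
    unfolding nxt_def using someI_ex[OF ex[OF that, of i]] .
  define Js where "Js = rec_nat J (\<lambda>i K. nxt K i)"
  define h where "h i = (SOME b. infinite {n \<in> Js i. f n i = b})" for i
  have [simp]: "Js 0 = J" "Js (Suc i) = nxt (Js i) i" for i by (auto simp: Js_def)
  have inf: "infinite (Js N)" for N by (induction N) (auto simp: assms nxt)
  have "Js N = {n \<in> J. \<forall>i<N. f n i = h i}" for N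
    by (induction N) (auto simp: nxt_def h_def less_Suc_eq)
  with inf have "infinite {n \<in> J. \<forall>i<N. f n i = h i}" for N by simp
  then show thesis by (rule that)
qed

text \<open>
  Koenig's lemma: geodesics from \<open>x\<close> to infinitely many points of \<open>Z\<close> converge to a geodesic ray, each
  initial segment of which is part of one of the geodesics.  This is why \<open>Z\<close> remains reachable from
  all vertices of the ray.
\<close>

lemma geodesic_ray_towards:
  assumes fin: "\<And>n x. finite {y. near E n x y}" and inf: "infinite Z"
    and reach: "\<And>z. z \<in> Z \<Longrightarrow> \<exists>n. near E n x z"
  obtains L where "\<And>n. geodesic_segment E L n" "L 0 = x" "\<And>n. \<exists>z\<in>Z. \<exists>m. near E m (L n) z"
proof -
  have "\<exists>z. z \<in> Z \<and> \<not> near E n x z" for n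
  proof (rule ccontr)
    assume "\<not> ?thesis"
    then have "Z \<subseteq> {y. near E n x y}" by blast
    with fin inf show False using finite_subset by blast
  qed
  then obtain z where z: "\<And>n. z n \<in> Z" "\<And>n. \<not> near E n x (z n)" by metis
  have "\<exists>g m. n \<le> m \<and> geodesic_segment E g m \<and> g 0 = x \<and> g m = z n" for n
  proof -
    obtain k where "near E k x (z n)" using reach z by blast
    then obtain g m where gm: "geodesic_segment E g m" "g 0 = x" "g m = z n" by (rule geodesic_exists)
    then have "near E m x (z n)" using geodesic_segmentD[OF gm(1), of 0 m m] by auto
    with z(2)[of n] have "n \<le> m" using near_mono[of E m x "z n" n] by (rule_tac ccontr) simp
    with gm show ?thesis by blast
  qed
  then obtain g m where g: "\<And>n. n \<le> m n" "\<And>n. geodesic_segment E (g n) (m n)" "\<And>n. g n 0 = x"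
    "\<And>n. g n (m n) = z n" by metis
  define f where "f n i = (if i \<le> m n then g n i else x)" for n i
  have "range (\<lambda>n. f n i) \<subseteq> {y. near E i x y}" for i
  proof clarify
    fix n show "near E i x (f n i)"
      using geodesic_segmentD[OF g(2)[of n], of 0 i i] g(3)[of n] by (auto simp: f_def)
  qed
  then have "finite (range (\<lambda>n. f n i))" for i using fin finite_subset by blast
  then obtain h where h: "\<And>N. infinite {n \<in> UNIV. \<forall>i<N. f n i = h i}"
    using pointwise_subsequence_limit[of f UNIV] by blast
  have *: "\<exists>n. N \<le> m n \<and> (\<forall>i\<le>N. g n i = h i)" for N
  proof -
    have "\<exists>n>N. n \<in> {n \<in> UNIV. \<forall>i<Suc N. f n i = h i}"
      using h[of "Suc N"] by (meson infinite_nat_iff_unbounded)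
    then obtain n where "n > N" "\<forall>i<Suc N. f n i = h i" by blast
    then show ?thesis using g(1)[of n] by (intro exI[of _ n]) (auto simp: f_def less_Suc_eq_le)
  qed
  show thesis
  proof
    show "geodesic_segment E h N" for N
    proof -
      obtain n where n: "N \<le> m n" "\<forall>i\<le>N. g n i = h i" using * by blast
      show ?thesis unfolding geodesic_segment_def
      proof (intro allI impI)
        fix i j k assume "i \<le> j" "j \<le> N"
        then show "near E k (h i) (h j) \<longleftrightarrow> j - i \<le> k"
          using n geodesic_segmentD[OF g(2)[of n], of i j k] by auto
      qed
    qed
    show "h 0 = x" using *[of 0] g(3) by auto
    show "\<exists>z\<in>Z. \<exists>m. near E m (h N) z" for N
    proof -
      obtain n where n: "N \<le> m n" "\<forall>i\<le>N. g n i = h i" using * by blast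
      then have "near E (m n - N) (h N) (z n)"
        using geodesic_segmentD[OF g(2)[of n], of N "m n" "m n - N"] g(4)[of n] by auto
      with z(1) show ?thesis by blast
    qed
  qed
qed

section \<open>Coarse comparison of sequences\<close>

text \<open>
  A version of \<^const>\<open>ray_le\<close> without balls.  It makes sense for all sequences of vertices, and up to the
  choice of the constant it does not notice a change of the generating set.
\<close>

definition coarse_le :: "'a rel \<Rightarrow> (nat \<Rightarrow> 'a) \<Rightarrow> (nat \<Rightarrow> 'a) \<Rightarrow> bool" where
  "coarse_le E R Q \<longleftrightarrow> (\<exists>M. infinite {i. \<exists>j. near E M (R i) (Q j)})"

lemma near_along_ray:
  assumes "\<And>i. (R i, R (Suc i)) \<in> E" "i \<le> j"
  shows "near E (j - i) (R i) (R j)"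
  by (rule near_chain[of j]) (simp_all only: near_edge assms order_refl)

lemma near_along_antiray:
  assumes "\<And>i. (R (Suc i), R i) \<in> E" "i \<le> j"
  shows "near E (j - i) (R j) (R i)"
  using assms(2)
proof (induction j)
  case (Suc j)
  show ?case
  proof (cases "i = Suc j")
    case False
    then have "near E 1 (R (Suc j)) (R j)" "near E (j - i) (R j) (R i)"
      using Suc near_edge[OF assms(1)] by auto
    from near_trans[OF this] show ?thesis using False Suc.prems by (simp add: Suc_diff_le)
  qed simp
qed simp

lemma qg_ray_iff:
  "qg_ray E R \<longleftrightarrow> inj R \<and> (\<forall>i. (R i, R (Suc i)) \<in> E) \<and>
     (\<exists>\<gamma>\<ge>1. \<exists>c\<ge>0. \<forall>i j m. i \<le> j \<longrightarrow> near E m (R i) (R j) \<longrightarrow> real (j - i) \<le> \<gamma> * real m + c)"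
  (is "?L \<longleftrightarrow> ?R")
proof
  assume ?L
  then obtain \<gamma> c where *: "inj R" "\<forall>i. (R i, R (Suc i)) \<in> E" "\<gamma> \<ge> 1" "c \<ge> 0"
    "\<And>i j. i \<le> j \<Longrightarrow> quasi_geodesic E \<gamma> c (map R [i..<Suc j])"
    unfolding qg_ray_def ray_def by blast
  have "real (j - i) \<le> \<gamma> * real m + c" if ij: "i \<le> j" and m: "near E m (R i) (R j)" for i j m
  proof -
    obtain d where d: "ddist E (R i) (R j) = enat d" "d \<le> m"
      using m unfolding near_def by (cases "ddist E (R i) (R j)") auto
    have nth: "map R [i..<Suc j] ! 0 = R i" "map R [i..<Suc j] ! (j - i) = R j"
      using ij by (simp_all del: upt_Suc)
    have "\<And>a b. a \<le> b \<Longrightarrow> b < length (map R [i..<Suc j]) \<Longrightarrow>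
      ereal (real (b - a)) \<le> ereal \<gamma> * ereal_of_enat
        (ddist E (map R [i..<Suc j] ! a) (map R [i..<Suc j] ! b)) + ereal c"
      using *(5)[OF ij] unfolding quasi_geodesic_def by blast
    from this[of 0 "j - i"] have "ereal (real (j - i)) \<le> ereal \<gamma> * ereal_of_enat (enat d) + ereal c"
      unfolding nth d(1) using ij by (simp del: upt_Suc)
    then have "real (j - i) \<le> \<gamma> * real d + c" by simp
    moreover have "\<gamma> * real d \<le> \<gamma> * real m" using d(2) *(3) by (intro mult_left_mono) auto
    ultimately show ?thesis by linarith
  qed
  with * show ?R by blast
next
  assume ?R
  then obtain \<gamma> c where *: "inj R" "\<And>i. (R i, R (Suc i)) \<in> E" "\<gamma> \<ge> 1" "c \<ge> 0"
    "\<And>i j m. i \<le> j \<Longrightarrow> near E m (R i) (R j) \<Longrightarrow> real (j - i) \<le> \<gamma> * real m + c"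
    by blast
  have "quasi_geodesic E \<gamma> c (map R [i..<Suc j])" if "i \<le> j" for i j
    unfolding quasi_geodesic_def
  proof (intro conjI allI impI)
    show "dpath E (map R [i..<Suc j])"
      using *(2) that by (auto simp: dpath_def successively_conv_nth simp del: upt_Suc)
    fix a b assume ab: "a \<le> b" "b < length (map R [i..<Suc j])"
    then have nth: "map R [i..<Suc j] ! a = R (i + a)" "map R [i..<Suc j] ! b = R (i + b)"
      by (simp_all del: upt_Suc)
    have "near E (b - a) (R (i + a)) (R (i + b))"
      using near_along_ray[of R E "i + a" "i + b"] *(2) ab by simp
    then obtain d where d: "ddist E (R (i + a)) (R (i + b)) = enat d"
      unfolding near_def by (cases "ddist E (R (i + a)) (R (i + b))") auto
    then have "near E d (R (i + a)) (R (i + b))" unfolding near_def by simp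
    from *(5)[OF _ this] have "real (b - a) \<le> \<gamma> * real d + c" using ab by simp
    then show "ereal (real (b - a)) \<le> ereal \<gamma> * ereal_of_enat
        (ddist E (map R [i..<Suc j] ! a) (map R [i..<Suc j] ! b)) + ereal c"
      unfolding nth d by simp
  qed
  with * show ?L unfolding qg_ray_def ray_def by blast
qed

definition qg_sequences :: "'a rel \<Rightarrow> (nat \<Rightarrow> 'a) set" where
  "qg_sequences E = Collect (qg_ray E) \<union> Collect (qg_antiray E)"

lemma qg_sequence_inj: "R \<in> qg_sequences E \<Longrightarrow> inj R"
  unfolding qg_sequences_def qg_ray_def qg_antiray_def ray_def antiray_def by blast

lemma qg_sequence_edges:
  "R \<in> qg_sequences E \<Longrightarrow> (\<forall>i. (R i, R (Suc i)) \<in> E) \<or> (\<forall>i. (R (Suc i), R i) \<in> E)"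
  unfolding qg_sequences_def qg_ray_def qg_antiray_def ray_def antiray_def by blast

lemma finite_near_initial:
  assumes "inj R" "finite {x. near E n x y}"
  shows "finite {i. near E n (R i) y}"
proof -
  have "finite (R -` {x. near E n x y})" using assms by (intro finite_vimageI)
  then show ?thesis by (simp add: vimage_def)
qed

text \<open>
  If infinitely many vertices of \<open>R\<close> admit a short path to \<open>Q\<close>, then all but finitely many of these
  paths avoid a given finite ball, as a path that meets the ball starts in a finite neighbourhood of
  it.  Conversely, a ball around the first vertex of \<open>R\<close> covers any given finite part of \<open>R\<close>: this is
  the choice of \<open>r\<close> in the proof.
\<close>

lemma ray_le_iff_coarse_le:
  assumes fin_in: "\<And>n y. finite {x. near E n x y}" and fin_out: "\<And>n x. finite {y. near E n x y}"
    and R: "R \<in> qg_sequences E"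
  shows "ray_le E R Q \<longleftrightarrow> coarse_le E R Q"
proof
  assume "ray_le E R Q"
  then obtain M where M: "\<And>r x. \<exists>p. dpath E p \<and> hd p \<in> range R \<and> last p \<in> range Q \<and>
        plen p \<le> M \<and> avoids_balls E r x p" unfolding ray_le_def by blast
  have "infinite {i. \<exists>j. near E M (R i) (Q j)}"
  proof
    assume "finite {i. \<exists>j. near E M (R i) (Q j)}"
    then obtain r where r: "\<And>i j. near E M (R i) (Q j) \<Longrightarrow> i \<le> r"
      by (auto simp: finite_nat_set_iff_bounded_le)
    obtain p where p: "dpath E p" "hd p \<in> range R" "last p \<in> range Q" "plen p \<le> M"
      "avoids_balls E r (R 0) p" using M by blast
    then obtain i j where ij: "hd p = R i" "last p = Q j" by blast
    have "(R i, Q j) \<in> E ^^ plen p"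
      using p(1) ij by (auto simp: walk_iff_relpow[symmetric] dpath_betw_def)
    with p(4) have "near E M (R i) (Q j)" unfolding near_iff_relpow by blast
    then have "i \<le> r" by (rule r)
    moreover have "near E i (R 0) (R i) \<or> near E i (R i) (R 0)"
      using qg_sequence_edges[OF R] near_along_ray[of R E 0 i] near_along_antiray[of R E 0 i] by auto
    ultimately have "R i \<in> out_ball E r (R 0) \<union> in_ball E r (R 0)"
      unfolding out_ball_def in_ball_def near_def by (auto intro: order_trans)
    moreover have "R i \<in> set p" using ij(1) p(1) by (metis dpath_def hd_in_set)
    ultimately show False using p(5) unfolding avoids_balls_def by blast
  qed
  then show "coarse_le E R Q" unfolding coarse_le_def by blast
next
  assume "coarse_le E R Q"
  then obtain M where M: "infinite {i. \<exists>j. near E M (R i) (Q j)}" unfolding coarse_le_def by blast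
  have "\<exists>p. dpath E p \<and> hd p \<in> range R \<and> last p \<in> range Q \<and> plen p \<le> M \<and> avoids_balls E r x p" for r x
  proof -
    let ?F = "{y. near E r x y} \<union> {y. near E r y x}"
    have "finite (\<Union>v\<in>?F. {i. near E M (R i) v})"
      using fin_in fin_out finite_near_initial[OF qg_sequence_inj[OF R]] by blast
    then obtain i j where ij: "near E M (R i) (Q j)" "\<And>v. v \<in> ?F \<Longrightarrow> \<not> near E M (R i) v"
      using M finite_subset[of "{i. \<exists>j. near E M (R i) (Q j)}" "\<Union>v\<in>?F. {i. near E M (R i) v}"] by blast
    then obtain p where p: "dpath_betw E (R i) p (Q j)" "plen p \<le> M"
      unfolding near_iff_relpow walk_iff_relpow[symmetric] by blast
    have "near E M (R i) v" if v: "v \<in> set p" for v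
    proof -
      from v obtain k where k: "k < length p" "v = p ! k" by (auto simp: in_set_conv_nth)
      have "near E 1 (p ! l) (p ! Suc l)" if "l < k" for l
        using p(1) that k(1) unfolding dpath_betw_def dpath_def successively_conv_nth
        by (intro near_edge) auto
      from near_chain[of k E "\<lambda>l. p ! l" 0 k, OF this] have "near E k (p ! 0) v" using k by simp
      moreover have "p ! 0 = R i" "k \<le> M"
        using p k(1) unfolding dpath_betw_def dpath_def plen_def by (auto simp: hd_conv_nth)
      ultimately show ?thesis using near_mono by metis
    qed
    with ij(2) have "set p \<inter> ?F = {}" by blast
    then have "avoids_balls E r x p"
      unfolding avoids_balls_def out_ball_def in_ball_def near_def by auto
    with p show ?thesis unfolding dpath_betw_def by blast
  qed
  then show "ray_le E R Q" unfolding ray_le_def by blast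
qed

section \<open>Cayley digraphs of cancellative semigroups\<close>

text \<open>
  The elements of \<open>products A n\<close> are the products of \<open>n + 1\<close> generators; a semigroup has no empty
  product.
\<close>

primrec products :: "'a::semigroup_mult set \<Rightarrow> nat \<Rightarrow> 'a set" where
  "products A 0 = A"
| "products A (Suc n) = {u * a | u a. u \<in> products A n \<and> a \<in> A}"

lemma products_mult: "u \<in> products A m \<Longrightarrow> v \<in> products A n \<Longrightarrow> u * v \<in> products A (Suc (m + n))"
proof (induction n arbitrary: v)
  case (Suc n)
  then obtain v' a where v: "v = v' * a" "v' \<in> products A n" "a \<in> A" by auto
  then have "u * v' \<in> products A (Suc (m + n))" using Suc by blast
  then show ?case using v by (auto simp: mult.assoc[symmetric])
qed auto

lemma finite_products: "finite A \<Longrightarrow> finite (products A n)"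
proof (induction n)
  case (Suc n)
  then have "finite ((\<lambda>(u, a). u * a) ` (products A n \<times> A))" by blast
  moreover have "products A (Suc n) = (\<lambda>(u, a). u * a) ` (products A n \<times> A)" by auto
  ultimately show ?case by simp
qed simp

locale fg_cancellative =
  fixes B :: "'a::semigroup_mult set"
  assumes left_cancel: "\<And>a b c :: 'a. a * b = a * c \<Longrightarrow> b = c"
    and right_cancel: "\<And>a b c :: 'a. b * a = c * a \<Longrightarrow> b = c"
    and generating: "finite_generating_set B"
begin

abbreviation D where "D \<equiv> cayley_digraph B"

lemma relpow_Suc_iff: "(x, y) \<in> D ^^ Suc k \<longleftrightarrow> (\<exists>u\<in>products B k. y = x * u)"
proof (induction k arbitrary: y)
  case 0
  then show ?case by (auto simp: cayley_digraph_def)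
next
  case (Suc k)
  have "(x, y) \<in> D ^^ Suc (Suc k) \<longleftrightarrow> (\<exists>z. (x, z) \<in> D ^^ Suc k \<and> (z, y) \<in> D)"
    by (auto simp del: relpow.simps(2) simp: relpow.simps(2)[of "Suc k"])
  also have "\<dots> \<longleftrightarrow> (\<exists>u\<in>products B k. \<exists>a\<in>B. y = x * u * a)"
    unfolding Suc by (auto simp: cayley_digraph_def)
  also have "\<dots> \<longleftrightarrow> (\<exists>u\<in>products B (Suc k). y = x * u)" by (auto simp: mult.assoc)
  finally show ?case .
qed

lemma near_iff: "near D n x y \<longleftrightarrow> x = y \<or> (\<exists>k<n. \<exists>u\<in>products B k. y = x * u)"
proof -
  have "near D n x y \<longleftrightarrow> x = y \<or> (\<exists>k<n. (x, y) \<in> D ^^ Suc k)"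
    unfolding near_iff_relpow
    by (metis Suc_leI Suc_le_lessD le0 near_0 near_iff_relpow not0_implies_Suc relpow_0_I relpow_0_E)
  then show ?thesis unfolding relpow_Suc_iff .
qed

lemma near_imp_mult: "near D n x y \<Longrightarrow> x \<noteq> y \<Longrightarrow> \<exists>u. y = x * u"
  unfolding near_iff by blast

lemma finite_out_ball: "finite {y. near D n x y}"
proof (rule finite_subset)
  show "{y. near D n x y} \<subseteq> insert x (\<Union>k<n. (\<lambda>u. x * u) ` products B k)"
    unfolding near_iff by auto
  show "finite (insert x (\<Union>k<n. (\<lambda>u. x * u) ` products B k))"
    using generating finite_products unfolding finite_generating_set_def by blast
qed

lemma finite_in_ball: "finite {x. near D n x y}"
proof (rule finite_subset)
  show "{x. near D n x y} \<subseteq> insert y (\<Union>k<n. \<Union>u\<in>products B k. {x. x * u = y})"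
    unfolding near_iff by auto
  have "finite {x. x * u = y}" for u
  proof (cases "\<exists>x. x * u = y")
    case True
    then obtain x where "x * u = y" by blast
    then have "{x. x * u = y} = {x}" using right_cancel by blast
    then show ?thesis by simp
  qed simp
  then show "finite (insert y (\<Union>k<n. \<Union>u\<in>products B k. {x. x * u = y}))"
    using generating finite_products unfolding finite_generating_set_def by blast
qed

lemma near_mult_left: "near D n (s * x) (s * y) \<longleftrightarrow> near D n x y"
  unfolding near_iff mult.assoc using left_cancel by metis

lemma edge_mult_left: "(s * x, s * y) \<in> D \<longleftrightarrow> (x, y) \<in> D"
  unfolding cayley_digraph_def using left_cancel by (auto simp: mult.assoc)

lemma in_some_products: "\<exists>k. u \<in> products B k"
proof -
  have "u \<in> generated_subsemigroup B" using generating by (simp add: finite_generating_set_def)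
  then show ?thesis
  proof induction
    case (base a)
    then show ?case by (intro exI[of _ 0]) simp
  next
    case (mult x y)
    then show ?case using products_mult by blast
  qed
qed

lemma reach_mult: "\<exists>n. near D n x (x * u)"
  using in_some_products[of u] unfolding near_iff by blast

text \<open>
  An element that is fixed by one right translation by \<open>u\<close> forces \<open>u\<close> to be idempotent, and an
  idempotent of a cancellative semigroup is a right identity.
\<close>

lemma fix_mult:
  fixes x u a :: 'a
  assumes fixed: "x * u = x"
  shows "a * u = a"
proof -
  have "x * (u * u) = x * u * u" by (rule mult.assoc[symmetric])
  also have "\<dots> = x * u" using fixed by simp
  finally have "u * u = u" by (rule left_cancel)
  then have "a * u * u = a * u" by (simp add: mult.assoc)
  then show "a * u = a" using right_cancel by blast
qed

text \<open>
  This replaces the norm of a group, where one would take \<open>x\<close> to be the identity.  Left cancellation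
  moves the base point, except for walks of length \<open>0\<close>, which are the subject of \<open>fix_mult\<close>.
\<close>

lemma near_homogeneous: "near D n x (x * u) \<longleftrightarrow> near D n a (a * u)"
  unfolding near_iff using left_cancel fix_mult by metis

lemma reach_uniform:
  assumes "finite F"
  obtains n where "\<And>x u. u \<in> F \<Longrightarrow> near D n x (x * u)"
proof -
  have "\<forall>u. \<exists>n. near D n u (u * u)" using reach_mult by blast
  then obtain f where f: "\<And>u. near D (f u) u (u * u)" by metis
  have "near D (Max (f ` F)) x (x * u)" if "u \<in> F" for x u
    using f near_homogeneous near_mono[of D "f u"] that assms by (metis Max_ge finite_imageI imageI)
  with that show thesis by blast
qed

text \<open>Every generator in \<open>A\<close> is a product of boundedly many generators in \<open>B\<close>.\<close>

lemma change_of_generators: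
  fixes A :: "'a set"
  assumes "finite A"
  obtains K where "\<And>n x y. near (cayley_digraph A) n x y \<Longrightarrow> near D (K * n) x y"
proof -
  obtain K where K: "\<And>x a. a \<in> A \<Longrightarrow> near D K x (x * a)" using reach_uniform[OF assms] by metis
  have "(x, y) \<in> cayley_digraph A ^^ n \<Longrightarrow> near D (K * n) x y" for n x y
  proof (induction n arbitrary: y)
    case (Suc n)
    then obtain z where "(x, z) \<in> cayley_digraph A ^^ n" "(z, y) \<in> cayley_digraph A" by auto
    then have "near D (K * n) x z" "near D K z y" using Suc K by (auto simp: cayley_digraph_def)
    from near_trans[OF this] show ?case by (simp add: add.commute)
  qed auto
  then have "near D (K * n) x y" if "near (cayley_digraph A) n x y" for n x y
    using that near_mono mult_le_mono2 unfolding near_iff_relpow[of "cayley_digraph A"] by metis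
  with that show thesis .
qed

lemma coarse_le_mult_left:
  "coarse_le D (\<lambda>i. s * R i) (\<lambda>i. s * Q i) \<longleftrightarrow> coarse_le D R Q"
  unfolding coarse_le_def near_mult_left ..

lemma qg_ray_mult_left:
  assumes "qg_ray D R"
  shows "qg_ray D (\<lambda>i. s * R i)"
proof -
  from assms have "inj (\<lambda>i. s * R i)" unfolding qg_ray_iff using left_cancel by (auto simp: inj_def)
  with assms show ?thesis unfolding qg_ray_iff near_mult_left edge_mult_left by blast
qed

lemma ray_le_iff: "R \<in> qg_sequences D \<Longrightarrow> ray_le D R Q \<longleftrightarrow> coarse_le D R Q"
  by (rule ray_le_iff_coarse_le) (auto simp: finite_in_ball finite_out_ball)

lemma coarse_le_refl: "coarse_le E R R"
proof -
  have "{i. \<exists>j. near E 0 (R i) (R j)} = UNIV" by auto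
  then show ?thesis unfolding coarse_le_def by (metis infinite_UNIV_nat)
qed

lemma ray_equiv_iff:
  "(R, Q) \<in> ray_equiv D \<longleftrightarrow> R \<in> qg_sequences D \<and> Q \<in> qg_sequences D \<and> coarse_le D R Q \<and> coarse_le D Q R"
  unfolding ray_equiv_def using ray_le_iff by (auto simp flip: qg_sequences_def)

lemma qg_boundary_eq: "qg_boundary D = qg_sequences D // ray_equiv D"
  unfolding qg_boundary_def qg_sequences_def ..

end

section \<open>Coarse rays and their translates\<close>

text \<open>
  Unlike the rays of the boundary, such a sequence need neither follow edges nor be injective.  This
  admits geodesic rays for another generating set and lines that are traversed against their direction.
\<close>

definition coarse_ray :: "'a rel \<Rightarrow> (nat \<Rightarrow> 'a) \<Rightarrow> bool" where
  "coarse_ray E w \<longleftrightarrow> (\<exists>K. (\<forall>i. near E K (w i) (w (Suc i))) \<and>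
     (\<forall>i j m. i \<le> j \<longrightarrow> near E m (w i) (w j) \<longrightarrow> j - i \<le> K * m + K))"

text \<open>
  Proceeding from the last visit of one vertex directly to the last visit of its successor removes
  all loops and all waiting times.  The gaps of the new parametrisation only improve the lower bound.
\<close>

lemma last_visit_erasure:
  assumes step: "\<And>i. v i = v (Suc i) \<or> (v i, v (Suc i)) \<in> E"
    and lower: "\<And>i j m. i \<le> j \<Longrightarrow> near E m (v i) (v j) \<Longrightarrow> j - i \<le> K * m + K"
  obtains \<sigma> where "qg_ray E (\<lambda>n. v (\<sigma> n))"
proof -
  define last where "last i = (GREATEST j. v j = v i)" for i :: nat
  \<comment> \<open>Visits of the same vertex have distance \<open>0\<close>.\<close>
  have bound: "j \<le> i + K" if "v j = v i" for i j
    using lower[of i j 0] that by (cases "i \<le> j") auto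
  have last_eq: "v (last i) = v i" and last_max: "\<And>j. v j = v i \<Longrightarrow> j \<le> last i" for i
    unfolding last_def using GreatestI_nat[of "\<lambda>j. v j = v i" i "i + K"]
      Greatest_le_nat[of "\<lambda>j. v j = v i" _ "i + K"] bound by auto
  define \<sigma> where "\<sigma> = rec_nat (last 0) (\<lambda>_ i. last (Suc i))"
  have \<sigma>_Suc: "\<sigma> (Suc n) = last (Suc (\<sigma> n))" for n by (simp add: \<sigma>_def)
  have mono: "\<sigma> n < \<sigma> (Suc n)" for n using last_max[of "Suc (\<sigma> n)" "Suc (\<sigma> n)"] by (simp add: \<sigma>_Suc)
  then have smono: "strict_mono \<sigma>" by (rule strict_mono_Suc_iff[THEN iffD2, rule_format])
  have fixed: "\<exists>i. \<sigma> n = last i" for n by (cases n) (auto simp: \<sigma>_def)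
  have final: "j \<le> \<sigma> n" if "v j = v (\<sigma> n)" for j n
    using fixed[of n] last_max last_eq that by metis
  have "inj (\<lambda>n. v (\<sigma> n))"
  proof (rule injI)
    fix m n assume "v (\<sigma> m) = v (\<sigma> n)"
    then have "\<sigma> m \<le> \<sigma> n" "\<sigma> n \<le> \<sigma> m" using final by metis+
    then show "m = n" using smono by (metis order_antisym strict_mono_eq)
  qed
  moreover have "(v (\<sigma> n), v (\<sigma> (Suc n))) \<in> E" for n
    using step[of "\<sigma> n"] final[of "Suc (\<sigma> n)" n] last_eq[of "Suc (\<sigma> n)"] by (auto simp: \<sigma>_Suc)
  moreover have "real (j - i) \<le> real (K + 1) * real m + real K"
    if "i \<le> j" "near E m (v (\<sigma> i)) (v (\<sigma> j))" for i j m
  proof -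
    have le: "\<sigma> i \<le> \<sigma> j" using smono that(1) by (simp add: strict_mono_less_eq)
    have "\<sigma> i + d \<le> \<sigma> (i + d)" for d
      by (induction d) (use mono in \<open>auto intro: order_trans[OF _ Suc_leI]\<close>)
    from this[of "j - i"] that(1) have "j - i \<le> \<sigma> j - \<sigma> i" by auto
    also have "\<dots> \<le> K * m + K" using lower[OF le that(2)] .
    also have "\<dots> \<le> (K + 1) * m + K" by simp
    finally show ?thesis by (metis of_nat_add of_nat_le_iff of_nat_mult)
  qed
  ultimately have "qg_ray E (\<lambda>n. v (\<sigma> n))"
    unfolding qg_ray_iff by (intro conjI exI[of _ "real (K + 1)"] exI[of _ "real K"]) auto
  with that show thesis .
qed

text \<open>
  Coarse rays represent boundary points: join consecutive vertices by short geodesics and erase loops.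
\<close>

lemma coarse_ray_near_qg_ray:
  assumes "coarse_ray E w"
  obtains R M where "qg_ray E R" "\<And>i. \<exists>j. near E M (R i) (w j)" "\<And>i. \<exists>j. near E M (w j) (R i)"
proof -
  from assms obtain K0 where K0: "\<And>i. near E K0 (w i) (w (Suc i))"
    "\<And>i j m. i \<le> j \<Longrightarrow> near E m (w i) (w j) \<Longrightarrow> j - i \<le> K0 * m + K0"
    unfolding coarse_ray_def by blast
  define K where "K = Suc K0"
  have K: "\<And>i. near E K (w i) (w (Suc i))" "K > 0"
    using K0(1) near_mono[of E K0] by (auto simp: K_def)
  have "\<exists>g m. m \<le> K \<and> geodesic_segment E g m \<and> g 0 = w i \<and> g m = w (Suc i)" for i
    using geodesic_exists[OF K(1)[of i]] by metis
  then obtain g m where g: "\<And>i. m i \<le> K" "\<And>i. geodesic_segment E (g i) (m i)" "\<And>i. g i 0 = w i"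
    "\<And>i. g i (m i) = w (Suc i)" by metis
  \<comment> \<open>Waiting at the end of each short geodesic gives all segments the same length \<open>K\<close>.\<close>
  define s where "s i r = g i (min r (m i))" for i r
  define v where "v q = s (q div K) (q mod K)" for q
  have s_ends: "s i 0 = w i" "s i K = w (Suc i)" for i
    using g(3,4)[of i] g(1)[of i] by (simp_all add: s_def min_absorb2)
  have s_step: "s i r = s i (Suc r) \<or> (s i r, s i (Suc r)) \<in> E" for i r
  proof (cases "r < m i")
    case True
    then have "near E 1 (g i r) (g i (Suc r))" using geodesic_segmentD[OF g(2)[of i], of r "Suc r" 1] by auto
    then have "g i r = g i (Suc r) \<or> (g i r, g i (Suc r)) \<in> E"
      unfolding near_iff_relpow by (auto simp: le_Suc_eq)
    then show ?thesis using True by (simp add: s_def min_def)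
  next
    case False
    then show ?thesis by (simp add: s_def min_def)
  qed
  have near_s: "near E K (w i) (s i r)" "near E K (s i r) (w (Suc i))" for i r
    using geodesic_segmentD[OF g(2)[of i], of 0 "min r (m i)" K] geodesic_segmentD[OF g(2)[of i], of "min r (m i)" "m i" K] g[of i]
    by (auto simp: s_def)
  have near_v: "near E K (w (q div K)) (v q)" "near E K (v q) (w (Suc (q div K)))" for q
    using near_s by (auto simp: v_def)
  have "v q = v (Suc q) \<or> (v q, v (Suc q)) \<in> E" for q
  proof (cases "Suc (q mod K) = K")
    case True
    then have "v (Suc q) = s (q div K) (Suc (q mod K))"
      using s_ends by (simp add: v_def div_Suc mod_Suc)
    then show ?thesis using s_step by (simp add: v_def)
  next
    case False
    then have "v (Suc q) = s (q div K) (Suc (q mod K))" by (simp add: v_def div_Suc mod_Suc)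
    then show ?thesis using s_step by (simp add: v_def)
  qed
  moreover
  define C where "C = K * (K0 + 2 * K * K0 + 2) + K0 * K + K"
  have "q - p \<le> C * n + C" if "p \<le> q" "near E n (v p) (v q)" for p q n
  proof -
    have "near E (K + n + K) (w (p div K)) (w (Suc (q div K)))"
      using near_v that(2) near_trans by metis
    then have "Suc (q div K) - p div K \<le> K0 * (K + n + K) + K0"
      using K0(2) that(1) by (metis div_le_mono le_SucI)
    then have "Suc (q div K) \<le> p div K + (K0 * (K + n + K) + K0)" by linarith
    then have "K * Suc (q div K) \<le> K * (p div K) + K * (K0 * (K + n + K) + K0)"
      by (metis mult_le_mono2 distrib_left)
    moreover have "q < K * Suc (q div K)" using K(2) by (simp add: dividend_less_times_div)
    moreover have "K * (p div K) \<le> p" by simp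
    ultimately have "q - p \<le> K * (K0 * (K + n + K) + K0)" by linarith
    also have "\<dots> = (K0 * K) * n + K * (2 * K * K0 + K0)" by (simp add: algebra_simps)
    also have "\<dots> \<le> C * n + C" unfolding C_def by (intro add_mono mult_le_mono1) (auto simp: algebra_simps)
    finally show ?thesis .
  qed
  ultimately obtain \<sigma> where "qg_ray E (\<lambda>n. v (\<sigma> n))" by (rule last_visit_erasure)
  then show thesis by (rule that[of _ K]) (use near_v in blast)+
qed

context fg_cancellative
begin

text \<open>
  Finiteness of the boundary is used in this form.  Left translation by \<open>s\<close> maps quasi-geodesic rays to
  quasi-geodesic rays, because a path from \<open>s * x\<close> to \<open>s * y\<close> is the translate of a path from \<open>x\<close> to \<open>y\<close>
  by left cancellation.  So the type of \<open>s\<close> is the boundary point of the translate by \<open>s\<close> of a fixed ray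
  near \<open>w\<close>.
\<close>

lemma finite_translate_types:
  assumes fin: "finite (qg_boundary D)" and w: "coarse_ray D w"
  obtains \<kappa> :: "'a \<Rightarrow> (nat \<Rightarrow> 'a) set" where "finite (range \<kappa>)"
    "\<And>s t. \<kappa> s = \<kappa> t \<Longrightarrow> coarse_le D (\<lambda>i. s * w i) (\<lambda>i. t * w i)"
proof -
  obtain R M where R: "qg_ray D R" "\<And>i. \<exists>j. near D M (R i) (w j)" "\<And>i. \<exists>j. near D M (w j) (R i)"
    using coarse_ray_near_qg_ray[OF w] by blast
  define \<kappa> where "\<kappa> s = ray_equiv D `` {\<lambda>i. s * R i}" for s
  have sR: "(\<lambda>i. s * R i) \<in> qg_sequences D" for s
    using qg_ray_mult_left[OF R(1)] by (auto simp: qg_sequences_def)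
  then have "range \<kappa> \<subseteq> qg_boundary D"
    unfolding \<kappa>_def qg_boundary_eq by (auto intro: quotientI)
  with fin have "finite (range \<kappa>)" by (rule finite_subset[rotated])
  moreover have "coarse_le D (\<lambda>i. s * w i) (\<lambda>i. t * w i)" if "\<kappa> s = \<kappa> t" for s t
  proof -
    have "(\<lambda>i. t * R i) \<in> \<kappa> t" unfolding \<kappa>_def ray_equiv_iff Image_singleton_iff
      using sR coarse_le_refl by blast
    then have "coarse_le D (\<lambda>i. s * R i) (\<lambda>i. t * R i)"
      unfolding that[symmetric] unfolding \<kappa>_def ray_equiv_iff Image_singleton_iff by blast
    then obtain N where N: "infinite {i. \<exists>j. near D N (s * R i) (t * R j)}" (is "infinite ?I")
      unfolding coarse_le_def by blast
    obtain a where a: "\<And>i. near D M (w (a i)) (R i)" using R(3) by metis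
    have "infinite (a ` ?I)"
    proof
      assume "finite (a ` ?I)"
      then have "finite (\<Union>k\<in>a ` ?I. {y. near D M (w k) y})"
        using finite_out_ball by (rule finite_UN_I)
      then have "finite (R -` (\<Union>k\<in>a ` ?I. {y. near D M (w k) y}))"
        by (rule finite_vimageI) (use R(1) in \<open>simp add: qg_ray_iff\<close>)
      moreover have "?I \<subseteq> R -` (\<Union>k\<in>a ` ?I. {y. near D M (w k) y})" using a by blast
      ultimately show False using N finite_subset by blast
    qed
    moreover have "a ` ?I \<subseteq> {i. \<exists>j. near D (M + N + M) (s * w i) (t * w j)}"
    proof clarify
      fix i j assume "near D N (s * R i) (t * R j)"
      moreover obtain l where "near D M (R j) (w l)" using R(2) by blast
      ultimately have "near D (M + N + M) (s * w (a i)) (t * w l)"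
        using a[of i] near_trans near_mult_left by metis
      then show "\<exists>j. near D (M + N + M) (s * w (a i)) (t * w j)" by blast
    qed
    ultimately show ?thesis unfolding coarse_le_def using finite_subset by blast
  qed
  ultimately show thesis using that by blast
qed

end

section \<open>Recurrence of translates\<close>

text \<open>
  The exponent is \<open>n + 1\<close>, because there need not be an identity element.
\<close>

primrec spow :: "'a::semigroup_mult \<Rightarrow> nat \<Rightarrow> 'a" where
  "spow c 0 = c"
| "spow c (Suc n) = c * spow c n"

lemma spow_add: "spow c (Suc (m + n)) = spow c m * spow c n"
  by (induction m) (auto simp: mult.assoc)

lemma geodesic_ray_imp_coarse_ray:
  assumes "\<And>n. geodesic_segment E L n"
  shows "coarse_ray E L"
  unfolding coarse_ray_def
proof (intro exI[of _ 1] conjI allI impI)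
  show "near E 1 (L i) (L (Suc i))" for i
    using geodesic_segmentD[OF assms[of "Suc i"], of i "Suc i" 1] by auto
  show "j - i \<le> 1 * m + 1" if "i \<le> j" "near E m (L i) (L j)" for i j m
    using geodesic_segmentD[OF assms[of j] that(1), of m] that(2) by auto
qed

lemma geodesic_ray_inj:
  assumes "\<And>n. geodesic_segment E L n"
  shows "inj L"
proof (rule linorder_injI)
  fix i j :: nat assume "i < j"
  then show "L i \<noteq> L j" using geodesic_segmentD[OF assms[of j], of i j 0] by auto
qed

locale finite_boundary_semigroup = fg_cancellative B
  for B :: "'a::semigroup_mult set" +
  fixes A :: "'a set"
  assumes generating': "finite_generating_set A"
    and finite_boundary: "finite (qg_boundary (cayley_digraph A))"
begin

sublocale A: fg_cancellative A
  using left_cancel right_cancel generating' by unfold_locales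

lemma near_from_A: obtains K where "\<And>n x y. near (cayley_digraph A) n x y \<Longrightarrow> near D (K * n) x y"
  using change_of_generators[of A] generating' unfolding finite_generating_set_def by metis

lemma near_to_A: obtains K where "\<And>n x y. near D n x y \<Longrightarrow> near (cayley_digraph A) (K * n) x y"
  using A.change_of_generators[of B] generating unfolding finite_generating_set_def by metis

lemma coarse_le_A_iff: "coarse_le (cayley_digraph A) R Q \<longleftrightarrow> coarse_le D R Q"
proof -
  obtain K where K: "\<And>n x y. near (cayley_digraph A) n x y \<Longrightarrow> near D (K * n) x y"
    using near_from_A by blast
  obtain K' where K': "\<And>n x y. near D n x y \<Longrightarrow> near (cayley_digraph A) (K' * n) x y"
    using near_to_A by blast
  show ?thesis
  proof
    assume "coarse_le (cayley_digraph A) R Q"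
    then obtain M where M: "infinite {i. \<exists>j. near (cayley_digraph A) M (R i) (Q j)}"
      unfolding coarse_le_def by blast
    have "{i. \<exists>j. near (cayley_digraph A) M (R i) (Q j)} \<subseteq> {i. \<exists>j. near D (K * M) (R i) (Q j)}"
      using K by blast
    with M show "coarse_le D R Q" unfolding coarse_le_def using finite_subset by blast
  next
    assume "coarse_le D R Q"
    then obtain M where M: "infinite {i. \<exists>j. near D M (R i) (Q j)}"
      unfolding coarse_le_def by blast
    have "{i. \<exists>j. near D M (R i) (Q j)} \<subseteq> {i. \<exists>j. near (cayley_digraph A) (K' * M) (R i) (Q j)}"
      using K' by blast
    with M show "coarse_le (cayley_digraph A) R Q" unfolding coarse_le_def using finite_subset by blast
  qed
qed

lemma coarse_ray_A:
  assumes "coarse_ray D w"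
  shows "coarse_ray (cayley_digraph A) w"
proof -
  obtain K where K: "\<And>n x y. near (cayley_digraph A) n x y \<Longrightarrow> near D (K * n) x y"
    using near_from_A by blast
  obtain K' where K': "\<And>n x y. near D n x y \<Longrightarrow> near (cayley_digraph A) (K' * n) x y"
    using near_to_A by blast
  obtain C where C: "\<And>i. near D C (w i) (w (Suc i))"
    "\<And>i j m. i \<le> j \<Longrightarrow> near D m (w i) (w j) \<Longrightarrow> j - i \<le> C * m + C"
    using assms unfolding coarse_ray_def by blast
  show ?thesis
    unfolding coarse_ray_def
  proof (intro exI[of _ "K' * C + C * K + C"] conjI allI impI)
    show "near (cayley_digraph A) (K' * C + C * K + C) (w i) (w (Suc i))" for i
      using near_mono[OF K'[OF C(1)[of i]]] by simp
    fix i j m assume "i \<le> j" "near (cayley_digraph A) m (w i) (w j)"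
    then have "j - i \<le> C * (K * m) + C" using C(2) K by blast
    also have "\<dots> \<le> (K' * C + C * K + C) * m + (K' * C + C * K + C)" by (simp add: algebra_simps)
    finally show "j - i \<le> (K' * C + C * K + C) * m + (K' * C + C * K + C)" .
  qed
qed

lemma translate_types:
  assumes "coarse_ray D w"
  obtains \<kappa> :: "'a \<Rightarrow> (nat \<Rightarrow> 'a) set" where "finite (range \<kappa>)"
    "\<And>s t. \<kappa> s = \<kappa> t \<Longrightarrow> coarse_le D (\<lambda>i. s * w i) (\<lambda>i. t * w i)"
  using A.finite_translate_types[OF finite_boundary coarse_ray_A[OF assms]]
  unfolding coarse_le_A_iff by blast

text \<open>
  Two powers of \<open>c\<close> have the same type; cancelling the smaller power shows that \<open>w\<close> is equivalent to its
  translate by a power \<open>c'\<close> of \<open>c\<close>.  The translate lies in the right ideal of \<open>c\<close>, so from every vertex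
  \<open>c\<close> there are directed paths to \<open>w\<close>.
\<close>

lemma translate_recurs:
  assumes "coarse_ray D w"
  obtains c' where "\<And>x. \<exists>y. c' * x = c * y"
    "coarse_le D w (\<lambda>i. c' * w i)" "coarse_le D (\<lambda>i. c' * w i) w"
proof -
  obtain \<kappa> :: "'a \<Rightarrow> (nat \<Rightarrow> 'a) set" where \<kappa>: "finite (range \<kappa>)"
    "\<And>s t. \<kappa> s = \<kappa> t \<Longrightarrow> coarse_le D (\<lambda>i. s * w i) (\<lambda>i. t * w i)"
    using translate_types[OF assms] by blast
  have "finite (range (\<lambda>n. \<kappa> (spow c n)))" using \<kappa>(1) by (rule finite_subset[rotated]) auto
  then have "\<not> inj (\<lambda>n. \<kappa> (spow c n))" using finite_imageD infinite_UNIV_nat by blast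
  then obtain i j where "i < j" and eq: "\<kappa> (spow c i) = \<kappa> (spow c j)"
    by (meson linorder_injI)
  then obtain k where k: "j = Suc (i + k)" using less_iff_Suc_add by auto
  define c' where "c' = spow c k"
  have j: "spow c j * x = spow c i * (c' * x)" for x unfolding k c'_def spow_add by (simp add: mult.assoc)
  show thesis
  proof
    show "\<exists>y. c' * x = c * y" for x unfolding c'_def by (cases k) (auto simp: mult.assoc)
    show "coarse_le D w (\<lambda>i. c' * w i)" "coarse_le D (\<lambda>i. c' * w i) w"
      using \<kappa>(2)[OF eq] \<kappa>(2)[OF eq[symmetric]] unfolding j coarse_le_mult_left .
  qed
qed

text \<open>
  The left divisors of \<open>f\<close> produce a geodesic ray \<open>L\<close> all of whose vertices have a path to one vertex.
  By recurrence, this vertex has a path back to \<open>L\<close>.  So a tail of \<open>L\<close> lies in a single strong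
  component, and after cancelling its first vertex it becomes a ray \<open>u\<close> of units.  By recurrence for
  \<open>u\<close>, every right ideal contains a unit, hence every element is a unit.
\<close>

lemma group_if_infinitely_many_left_divisors:
  fixes f :: 'a
  assumes inf: "infinite {z. \<exists>h. z * h = f}"
  obtains e :: 'a and i where "\<And>x. e * x = x" "\<And>x. x * e = x" "\<And>x. i x * x = e" "\<And>x. x * i x = e"
proof -
  let ?Z = "(\<lambda>z. f * z) ` {z. \<exists>h. z * h = f}"
  have reach: "\<exists>n. near D n f z" if "z \<in> ?Z" for z using that reach_mult by auto
  \<comment> \<open>Translation by \<open>f\<close> makes all left divisors reachable from \<open>f\<close>; they become left divisors of \<open>f * f\<close>.\<close>
  have "inj_on (\<lambda>z. f * z) {z. \<exists>h. z * h = f}" using left_cancel by (auto simp: inj_on_def)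
  with inf have infZ: "infinite ?Z" using finite_imageD by blast
  obtain L where L: "\<And>n. geodesic_segment D L n" "L 0 = f" "\<And>n. \<exists>z\<in>?Z. \<exists>m. near D m (L n) z"
    by (rule geodesic_ray_towards[OF finite_out_ball infZ reach], assumption) (rule that)
  have to_f: "\<exists>m. near D m (L n) (f * f)" for n
  proof -
    obtain z m h where z: "near D m (L n) (f * z)" "z * h = f" using L(3)[of n] by auto
    obtain m' where "near D m' (f * z) (f * z * h)" using reach_mult by blast
    from near_trans[OF z(1) this] show ?thesis using z(2) by (auto simp: mult.assoc)
  qed
  \<comment> \<open>The ray runs into the sink \<open>f * f\<close> from everywhere; recurrence leads back from the sink to
    the ray, which closes cycles.\<close>
  obtain c where c: "\<And>x. \<exists>y. c * x = f * f * y" "coarse_le D (\<lambda>i. c * L i) L"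
    using translate_recurs[OF geodesic_ray_imp_coarse_ray[OF L(1)], of "f * f"] by metis
  obtain i j m where ij: "near D m (c * L i) (L j)"
    using c(2) unfolding coarse_le_def using infinite_imp_nonempty by blast
  obtain y where y: "c * L i = f * f * y" using c(1) by blast
  define x where "x = L j"
  obtain m' where "near D m' (f * f) (f * f * y)" using reach_mult by blast
  from near_trans[OF this ij[unfolded y]] have to_x: "\<exists>m. near D m (f * f) x" unfolding x_def by blast
  have "\<exists>u v. L (Suc (j + k)) = x * u \<and> x * (u * v) = x" for k
  proof -
    have "near D (Suc k) x (L (Suc (j + k)))" "\<not> near D 0 x (L (Suc (j + k)))"
      using geodesic_segmentD[OF L(1)[of "Suc (j + k)"], of j "Suc (j + k)"] unfolding x_def
      by (simp_all del: near_0)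
    then obtain u where u: "L (Suc (j + k)) = x * u" using near_imp_mult by fastforce
    obtain m where "near D m (x * u) x" using near_trans to_f[of "Suc (j + k)"] to_x u by metis
    moreover have "x * u \<noteq> x" using \<open>\<not> near D 0 x (L (Suc (j + k)))\<close> u by auto
    ultimately obtain v where "x = x * u * v" using near_imp_mult by blast
    with u show ?thesis by (metis mult.assoc)
  qed
  then obtain u v where uv: "\<And>k. L (Suc (j + k)) = x * u k" "\<And>k. x * (u k * v k) = x" by metis
  define e where "e = u 0 * v 0"
  have right_id: "a * e = a" for a using fix_mult[OF uv(2)[of 0]] by (simp add: e_def)
  have left_id: "e * a = a" for a
    by (rule left_cancel[of a]) (simp add: right_id mult.assoc[symmetric])
  have unit: "u k * v k = e" for k
    by (rule left_cancel[of x]) (simp add: right_id uv)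
  have "geodesic_segment D u n" for n
    unfolding geodesic_segment_def
  proof (intro allI impI)
    fix i k m assume "i \<le> k" "k \<le> n"
    then show "near D m (u i) (u k) \<longleftrightarrow> k - i \<le> m"
      using geodesic_segmentD[OF L(1)[of "Suc (j + k)"], of "Suc (j + i)" "Suc (j + k)" m]
      by (simp add: uv(1) near_mult_left)
  qed
  then have ray: "coarse_ray D u" by (rule geodesic_ray_imp_coarse_ray)
  have right_inverse: "\<exists>b. a * b = e" for a
  proof -
    obtain c where c: "\<And>x. \<exists>y. c * x = a * y" "coarse_le D (\<lambda>i. c * u i) u"
      using translate_recurs[OF ray, of a] by metis
    obtain i k m where ik: "near D m (c * u i) (u k)"
      using c(2) unfolding coarse_le_def using infinite_imp_nonempty by blast
    obtain y where y: "c * u i = a * y" using c(1) by blast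
    have "\<exists>h. u k = a * h" using near_imp_mult[OF ik] unfolding y by (metis mult.assoc)
    then show ?thesis using unit[of k] by (metis mult.assoc)
  qed
  then obtain inverse where inverse: "\<And>a. a * inverse a = e" by metis
  have left_inverse: "inverse a * a = e" for a
    by (rule left_cancel[of a]) (simp add: inverse left_id right_id mult.assoc[symmetric])
  show thesis by (rule that[OF left_id right_id left_inverse inverse])
qed

end

section \<open>Semigroups whose elements have finitely many left divisors\<close>

context fg_cancellative
begin

text \<open>
  If \<open>y = x * w * v\<close> is close to \<open>x\<close>, then \<open>w * v\<close> is one of finitely many elements.  These have finitely
  many left divisors, so there are only finitely many possibilities for \<open>w\<close> and \<open>v\<close>.
\<close>

lemma intermediate_points_close:
  assumes fin: "\<And>f :: 'a. finite {z. \<exists>h. z * h = f}"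
  obtains K where "\<And>x c y m n. near D r x y \<Longrightarrow> near D m x c \<Longrightarrow> near D n c y \<Longrightarrow>
    near D K x c \<and> near D K c y"
proof -
  fix a :: 'a
  define U where "U = {u. near D r a (a * u)}"
  have "finite U"
    unfolding U_def using finite_vimageI[OF finite_out_ball[of r a], of "\<lambda>u. a * u"] left_cancel
    by (auto simp: vimage_def inj_def)
  define W where "W = (\<Union>u\<in>U. {z. \<exists>h. z * h = u})"
  define V where "V = (\<Union>u\<in>U. \<Union>w\<in>W. {v. w * v = u})"
  have "finite W" unfolding W_def using \<open>finite U\<close> fin by blast
  have "finite {v. w * v = u}" for w u :: 'a
  proof (cases "\<exists>v. w * v = u")
    case True
    then obtain v where "w * v = u" by blast
    then have "{v. w * v = u} = {v}" using left_cancel by blast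
    then show ?thesis by simp
  qed simp
  then have "finite V" unfolding V_def using \<open>finite U\<close> \<open>finite W\<close> by blast
  with \<open>finite W\<close> obtain N where N: "\<And>x u. u \<in> W \<union> V \<Longrightarrow> near D N x (x * u)"
    using reach_uniform[of "W \<union> V"] by blast
  have "near D (N + r) x c \<and> near D (N + r) c y"
    if xy: "near D r x y" and xc: "near D m x c" and cy: "near D n c y" for x c y m n
  proof (cases "x = c \<or> c = y")
    case True
    then show ?thesis using xy near_mono[OF xy] by auto
  next
    case False
    then obtain w v where w: "c = x * w" and v: "y = c * v" using near_imp_mult xc cy by metis
    then have "w * v \<in> U" using xy near_homogeneous[of r x "w * v" a] by (simp add: U_def mult.assoc)
    then have "w \<in> W" "v \<in> V" unfolding W_def V_def by blast+
    then show ?thesis using N near_mono[of D N] w v by (metis UnCI le_add1)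
  qed
  then show thesis using that by blast
qed

end

lemma discrete_intermediate_value:
  fixes \<psi> :: "nat \<Rightarrow> nat"
  assumes "\<psi> 0 \<le> m" "\<And>k. k < N \<Longrightarrow> \<psi> (Suc k) \<le> \<psi> k + K" "m \<le> \<psi> N"
  obtains k where "k \<le> N" "m \<le> \<psi> k" "\<psi> k \<le> m + K"
proof -
  define k where "k = (LEAST k. m \<le> \<psi> k)"
  have k: "m \<le> \<psi> k" "k \<le> N" unfolding k_def using assms(3) by (auto intro: LeastI Least_le)
  have "\<psi> k \<le> m + K"
  proof (cases k)
    case (Suc l)
    then have "\<psi> l < m" unfolding k_def by (metis lessI not_less_Least not_le)
    with assms(2)[of l] Suc k(2) show ?thesis by simp
  qed (use assms(1) in auto)
  with k that show thesis by blast
qed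

locale finite_boundary_hyperbolic = finite_boundary_semigroup +
  fixes \<delta> :: nat
  assumes thin: "thin_transitive D \<delta>"
begin

lemma thin_sides:
  assumes "geodesic_segment D f l" "geodesic_segment D g m" "geodesic_segment D h n" "f 0 = h 0" "f l = g 0" "g m = h n"
  shows "i \<le> n \<Longrightarrow> (\<exists>j\<le>l. near D \<delta> (f j) (h i)) \<or> (\<exists>j\<le>m. near D \<delta> (h i) (g j))"
    and "i \<le> l \<Longrightarrow> (\<exists>j\<le>n. near D \<delta> (h j) (f i)) \<or> (\<exists>j\<le>m. near D \<delta> (f i) (g j))"
    and "i \<le> m \<Longrightarrow> (\<exists>j\<le>l. near D \<delta> (f j) (g i)) \<or> (\<exists>j\<le>n. near D \<delta> (g i) (h j))"
  using thin[unfolded thin_transitive_def, rule_format, OF assms] by blast+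

text \<open>
  In-balls are finite and \<open>R\<close> is injective, so only finitely many vertices of \<open>R\<close> have short paths into
  the finite set \<open>V\<close>.
\<close>

lemma coarse_le_far_pairs:
  assumes "coarse_le D R Q" "inj R"
  obtains M where "\<And>N V. finite V \<Longrightarrow> \<exists>j\<ge>N. \<exists>i. near D M (R j) (Q i) \<and> Q i \<notin> V"
proof -
  obtain M where M: "infinite {j. \<exists>i. near D M (R j) (Q i)}"
    using assms(1) unfolding coarse_le_def by blast
  have "\<exists>j\<ge>N. \<exists>i. near D M (R j) (Q i) \<and> Q i \<notin> V" if "finite V" for N V
  proof -
    have "finite ({..<N} \<union> (\<Union>v\<in>V. {j. near D M (R j) v}))" (is "finite ?F")
      using that finite_near_initial[OF assms(2) finite_in_ball] by blast
    then have "infinite ({j. \<exists>i. near D M (R j) (Q i)} - ?F)" using M by (rule Diff_infinite_finite)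
    then obtain j where "j \<in> {j. \<exists>i. near D M (R j) (Q i)} - ?F" using infinite_imp_nonempty by blast
    then show ?thesis by (intro exI[of _ j]) (auto simp: not_less)
  qed
  with that show thesis by blast
qed

text \<open>
  Let \<open>c\<close> be reachable from \<open>L 0\<close>.  By recurrence there is a translate of \<open>L\<close> that is reachable
  from \<open>c\<close> and to which \<open>L\<close> has short paths arbitrarily far out, from \<open>L j\<close> to \<open>c' * L i\<close> say.
  Two geodesic triangles share the side \<open>G\<close> from \<open>L 0\<close> to \<open>c' * L i\<close>: one has the further vertex
  \<open>c\<close>, the other one \<open>L j\<close>, and its side from \<open>L j\<close> is short.

  A point shortly before \<open>c\<close> cannot be close to the side behind \<open>c\<close>, since then \<open>c\<close> would be an
  intermediate point at a bounded distance; so it has a short path from \<open>G\<close>, and hence from \<open>L\<close>.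
  In the same way a point \<open>y\<close> shortly behind \<open>c\<close> has a short path to \<open>G\<close>.  To get from \<open>G\<close> on
  to \<open>L\<close>, note that the vertices of \<open>L\<close> well before \<open>L j\<close> have short paths from \<open>G\<close>, and that
  the positions on \<open>G\<close> where these paths start make only bounded steps.  So \<open>G\<close> has such a position
  within bounded distance after any of its vertices that are not too far from \<open>L 0\<close>.
\<close>

lemma geodesic_ray_tracks_all:
  assumes fin: "\<And>f :: 'a. finite {z. \<exists>h. z * h = f}" and L: "\<And>n. geodesic_segment D L n"
  obtains C where "\<And>c n. near D n (L 0) c \<Longrightarrow> (\<exists>k. near D C (L k) c) \<and> (\<exists>k. near D C c (L k))"
proof -
  obtain K where K: "\<And>x c y m n. near D \<delta> x y \<Longrightarrow> near D m x c \<Longrightarrow> near D n c y \<Longrightarrow>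
    near D K x c \<and> near D K c y" using intermediate_points_close[OF fin] by blast
  obtain K' where K': "\<And>x c y m n. near D (\<delta> + 1) x y \<Longrightarrow> near D m x c \<Longrightarrow> near D n c y \<Longrightarrow>
    near D K' x c \<and> near D K' c y" using intermediate_points_close[OF fin] by blast
  \<comment> \<open>This bounds the length of the path from \<open>c\<close> via \<open>y\<close>, two points of \<open>G\<close>, to \<open>L\<close>; the shorter path
    from \<open>L\<close> via \<open>G\<close> to \<open>c\<close> obeys the same bound.\<close>
  define C where "C = K + 1 + \<delta> + K' + \<delta>"
  have LD: "near D m (L i) (L j) \<longleftrightarrow> j - i \<le> m" if "i \<le> j" for i j m
    using geodesic_segmentD[OF L[of j] that] by simp
  have "(\<exists>k. near D C (L k) c) \<and> (\<exists>k. near D C c (L k))" if c0: "near D n (L 0) c" for c n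
  proof -
    obtain Kn where Kn: "\<And>x c y m k. near D n x y \<Longrightarrow> near D m x c \<Longrightarrow> near D k c y \<Longrightarrow>
      near D Kn x c \<and> near D Kn c y" using intermediate_points_close[OF fin] by blast
    obtain g l where g: "l \<le> n" "geodesic_segment D g l" "g 0 = L 0" "g l = c"
      using geodesic_exists[OF c0] by metis
    obtain c' where c': "\<And>x. \<exists>y. c' * x = c * y" "coarse_le D L (\<lambda>i. c' * L i)"
      using translate_recurs[OF geodesic_ray_imp_coarse_ray[OF L], of c] by metis
    obtain M where M: "\<And>N V. finite V \<Longrightarrow> \<exists>j\<ge>N. \<exists>i. near D M (L j) (c' * L i) \<and> c' * L i \<notin> V"
      using coarse_le_far_pairs[OF c'(2) geodesic_ray_inj[OF L]] by blast
    have sides: "\<exists>T t G q S s. geodesic_segment D T t \<and> T 0 = c \<and> T t = c' * L i \<and>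
        geodesic_segment D G q \<and> G 0 = L 0 \<and> G q = c' * L i \<and> s \<le> M \<and> geodesic_segment D S s \<and> S 0 = L j \<and> S s = c' * L i"
      if "near D M (L j) (c' * L i)" for i j
    proof -
      obtain y where "c' * L i = c * y" using c'(1) by blast
      then obtain a where a: "near D a c (c' * L i)" using reach_mult by metis
      then have b: "near D (n + a) (L 0) (c' * L i)" by (rule near_trans[OF c0])
      show ?thesis using geodesic_exists[OF a] geodesic_exists[OF b] geodesic_exists[OF \<open>near D M (L j) (c' * L i)\<close>]
        by metis
    qed
    have "\<exists>k. near D C (L k) c"
    proof (cases "l \<le> K + 1")
      case True
      then have "near D (K + 1) (L 0) c" using geodesic_segmentD[OF g(2), of 0 l "K + 1"] g by simp
      then show ?thesis using near_mono[of D "K + 1" _ _ C] by (auto simp: C_def)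
    next
      case False
      obtain j i where ji: "near D M (L j) (c' * L i)" "c' * L i \<notin> {v. near D (Kn + \<delta> + M) (L 0) v}"
        using M[OF finite_out_ball] by blast
      from sides[OF ji(1)] obtain T t G q S s where T: "geodesic_segment D T t" "T 0 = c" "T t = c' * L i"
        and G: "geodesic_segment D G q" "G 0 = L 0" "G q = c' * L i"
        and S: "s \<le> M" "geodesic_segment D S s" "S 0 = L j" "S s = c' * L i" by blast
      define y where "y = g (l - (K + 1))"
      have yc: "near D m y c \<longleftrightarrow> K + 1 \<le> m" for m
        using geodesic_segmentD[OF g(2), of "l - (K + 1)" l m] False g(4) by (simp add: y_def)
      have "(\<exists>p\<le>q. near D \<delta> (G p) y) \<or> (\<exists>p\<le>t. near D \<delta> y (T p))"
        unfolding y_def by (rule thin_sides(2)[OF g(2) T(1) G(1)]) (use g T G in auto)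
      moreover have False if p: "p \<le> t" "near D \<delta> y (T p)" for p
      proof -
        have "near D p c (T p)" using geodesic_segmentD[OF T(1), of 0 p p] T p by simp
        then have "near D K y c" using K[OF p(2), of "K + 1" c p] yc by auto
        then show False by (simp add: yc)
      qed
      ultimately obtain p where p: "p \<le> q" "near D \<delta> (G p) y" by blast
      have "(\<exists>k\<le>j. near D \<delta> (L k) (G p)) \<or> (\<exists>r\<le>s. near D \<delta> (G p) (S r))"
        by (rule thin_sides(1)[OF L S(2) G(1)]) (use S G p in auto)
      moreover have False if r: "r \<le> s" "near D \<delta> (G p) (S r)" for r
      proof -
        have "near D n (L 0) y" "near D p (L 0) (G p)" "near D M (S r) (c' * L i)"
          using geodesic_segmentD[OF g(2), of 0 "l - (K + 1)" n] g geodesic_segmentD[OF G(1), of 0 p p] G p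
            geodesic_segmentD[OF S(2), of r s M] S r by (auto simp: y_def)
        with Kn p(2) r(2) have "near D (Kn + \<delta> + M) (L 0) (c' * L i)" using near_trans by metis
        with ji(2) show False by blast
      qed
      ultimately obtain k where "near D \<delta> (L k) (G p)" by blast
      then have "near D (\<delta> + \<delta> + (K + 1)) (L k) c" using p yc near_trans by (metis order_refl)
      then show ?thesis using near_mono[of D "\<delta> + \<delta> + (K + 1)" _ _ C] by (auto simp: C_def)
    qed
    moreover have "\<exists>k. near D C c (L k)"
    proof -
      define m where "m = n + (K + 1) + \<delta>"
      obtain j i where j: "j \<ge> K + 1 + \<delta> + m"
        and ji: "near D M (L j) (c' * L i)" "c' * L i \<notin> {v. near D (K + 1) c v}"
        using M[OF finite_out_ball] by blast
      from sides[OF ji(1)] obtain T t G q S s where T: "geodesic_segment D T t" "T 0 = c" "T t = c' * L i"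
        and G: "geodesic_segment D G q" "G 0 = L 0" "G q = c' * L i"
        and S: "s \<le> M" "geodesic_segment D S s" "S 0 = L j" "S s = c' * L i" by blast
      have t: "K + 1 < t" using ji(2) geodesic_segmentD[OF T(1), of 0 t "K + 1"] T by simp
      define y where "y = T (K + 1)"
      have cy: "near D m c y \<longleftrightarrow> K + 1 \<le> m" for m
        using geodesic_segmentD[OF T(1), of 0 "K + 1" m] t T by (simp add: y_def)
      have "(\<exists>p\<le>l. near D \<delta> (g p) y) \<or> (\<exists>p\<le>q. near D \<delta> y (G p))"
        unfolding y_def by (rule thin_sides(3)[OF g(2) T(1) G(1)]) (use g T G t in auto)
      moreover have False if p: "p \<le> l" "near D \<delta> (g p) y" for p
      proof -
        have "near D l (g p) c" using geodesic_segmentD[OF g(2), of p l l] g p by simp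
        then have "near D K c y" using K[OF p(2), of l c "K + 1"] cy by auto
        then show False by (simp add: cy)
      qed
      ultimately obtain p where p: "p \<le> q" "near D \<delta> y (G p)" by blast
      have "near D m (L 0) (G p)" unfolding m_def using c0 cy p(2) near_trans by (metis order_refl)
      then have pm: "p \<le> m" using geodesic_segmentD[OF G(1), of 0 p m] G p by simp
      have "\<exists>p\<le>q. near D \<delta> (G p) (L k)" if k: "k < j - K" for k
      proof -
        have "(\<exists>p\<le>q. near D \<delta> (G p) (L k)) \<or> (\<exists>r\<le>s. near D \<delta> (L k) (S r))"
          by (rule thin_sides(2)[OF L S(2) G(1)]) (use S G k in auto)
        moreover have False if r: "r \<le> s" "near D \<delta> (L k) (S r)" for r
        proof -
          have "near D r (L j) (S r)" using geodesic_segmentD[OF S(2), of 0 r r] S r by simp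
          then have "near D K (L k) (L j)" using K[OF r(2), of "j - k" "L j" r] LD[of k j] k by auto
          then show False using LD[of k j] k by simp
        qed
        ultimately show ?thesis by blast
      qed
      then obtain \<psi>' where \<psi>': "\<And>k. k < j - K \<Longrightarrow> \<psi>' k \<le> q \<and> near D \<delta> (G (\<psi>' k)) (L k)" by metis
      \<comment> \<open>\<open>G\<close> and \<open>L\<close> have the same first vertex, so the positions may be taken to begin with \<open>0\<close>.\<close>
      define \<psi> where "\<psi> k = (if k = 0 then 0 else \<psi>' k)" for k
      have \<psi>: "\<psi> k \<le> q" "near D \<delta> (G (\<psi> k)) (L k)" if "k < j - K" for k
        using \<psi>'[OF that] G(2) by (auto simp: \<psi>_def)
      have step: "\<psi> (Suc k) \<le> \<psi> k + K'" if k: "k < j - K - 1" for k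
      proof (rule ccontr)
        assume "\<not> ?thesis"
        then have less: "\<psi> k + K' < \<psi> (Suc k)" by simp
        have 1: "near D (\<psi> (Suc k) - \<psi> k) (G (\<psi> k)) (G (\<psi> (Suc k)))"
          using geodesic_segmentD[OF G(1), of "\<psi> k" "\<psi> (Suc k)"] \<psi>(1)[of "Suc k"] less k by simp
        have "near D (\<delta> + 1) (G (\<psi> k)) (L (Suc k))"
          by (rule near_trans[OF \<psi>(2)]) (use k LD[of k "Suc k"] in auto)
        from K'[OF this 1 \<psi>(2)] k have "near D K' (G (\<psi> k)) (G (\<psi> (Suc k)))" by simp
        then show False
          using geodesic_segmentD[OF G(1), of "\<psi> k" "\<psi> (Suc k)" K'] \<psi>(1)[of "Suc k"] less k by simp
      qed
      have last: "j - K - 1 < j - K" using j by simp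
      have "near D (\<psi> (j - K - 1)) (L 0) (G (\<psi> (j - K - 1)))"
        using geodesic_segmentD[OF G(1), of 0 "\<psi> (j - K - 1)"] \<psi>(1)[OF last] G by simp
      from near_trans[OF this \<psi>(2)[OF last]] have "j - K - 1 \<le> \<psi> (j - K - 1) + \<delta>" using LD by simp
      then have "p \<le> \<psi> (j - K - 1)" using pm j by linarith
      then obtain k where k: "k \<le> j - K - 1" "p \<le> \<psi> k" "\<psi> k \<le> p + K'"
        using discrete_intermediate_value[of \<psi> p "j - K - 1" K'] step by (auto simp: \<psi>_def)
      then have kj: "k < j - K" using last by simp
      have 1: "near D (K + 1) c y" by (simp add: cy)
      have 2: "near D K' (G p) (G (\<psi> k))" using geodesic_segmentD[OF G(1), of p "\<psi> k" K'] \<psi>(1)[OF kj] k by simp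
      have "near D C c (L k)"
        unfolding C_def by (rule near_trans[OF near_trans[OF near_trans[OF 1 p(2)] 2] \<psi>(2)[OF kj]])
      then show ?thesis ..
    qed
    ultimately show ?thesis ..
  qed
  with that show thesis by blast
qed

text \<open>
  There are no anti-rays, since the vertices of an anti-ray are left divisors of its first vertex.
  A ray that starts behind \<open>L 0\<close> is tracked by the geodesic ray \<open>L\<close>, so that short paths lead from \<open>R\<close> to
  \<open>L\<close> and from \<open>L\<close> to \<open>Q\<close>.  The positions on \<open>L\<close> that are visited by \<open>Q\<close> make bounded steps, so \<open>Q\<close> is met
  soon after reaching \<open>L\<close>.  Left translation by \<open>L 0\<close> reduces the general case to this one.
\<close>

lemma boundary_trivial_if_finitely_many_left_divisors:
  assumes fin: "\<And>f :: 'a. finite {z. \<exists>h. z * h = f}" and inf: "infinite (UNIV :: 'a set)"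
  shows "qg_boundary (cayley_digraph A) \<subseteq> {qg_sequences (cayley_digraph A)}"
proof -
  let ?X = "qg_sequences (cayley_digraph A)"
  fix z0 :: 'a
  have infZ: "infinite (range (\<lambda>z. z0 * z))"
    using inf left_cancel by (metis finite_imageD injI)
  have "\<exists>n. near D n z0 z" if "z \<in> range (\<lambda>z. z0 * z)" for z using that reach_mult by auto
  from geodesic_ray_towards[OF finite_out_ball infZ this]
  obtain L where L: "\<And>n. geodesic_segment D L n" "L 0 = z0" by metis
  obtain C where C: "\<And>c n. near D n (L 0) c \<Longrightarrow> (\<exists>k. near D C (L k) c) \<and> (\<exists>k. near D C c (L k))"
    using geodesic_ray_tracks_all[OF fin L(1)] by metis
  obtain K1 where K1: "\<And>n x y. near (cayley_digraph A) n x y \<Longrightarrow> near D (K1 * n) x y"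
    using near_from_A by blast
  obtain K2 where K2: "\<And>x c y m n. near D (C + K1) x y \<Longrightarrow> near D m x c \<Longrightarrow> near D n c y \<Longrightarrow>
    near D K2 x c \<and> near D K2 c y" using intermediate_points_close[OF fin] by blast
  have edges: "(R i, R (Suc i)) \<in> cayley_digraph A" if R: "R \<in> ?X" for R i
  proof (rule ccontr)
    assume "\<not> ?thesis"
    then have anti: "\<And>i. (R (Suc i), R i) \<in> cayley_digraph A" using qg_sequence_edges[OF R] by blast
    have "R i \<in> {z. \<exists>h. z * h = R 0}" if "i \<in> {1..}" for i
    proof -
      have "near (cayley_digraph A) i (R i) (R 0)"
        using near_along_antiray[of R "cayley_digraph A" 0 i] anti by simp
      moreover have "R i \<noteq> R 0" using that qg_sequence_inj[OF R] by (auto dest: injD)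
      ultimately show ?thesis using A.near_imp_mult by (metis (mono_tags) mem_Collect_eq)
    qed
    then have "R ` {1..} \<subseteq> {z. \<exists>h. z * h = R 0}" by blast
    then have "finite (R ` {1..})" using fin finite_subset by blast
    then have "finite {1 :: nat..}" using qg_sequence_inj[OF R] by (metis finite_imageD inj_on_subset subset_UNIV)
    then show False using infinite_Ici by blast
  qed
  have "coarse_le D R Q" if R: "R \<in> ?X" and Q: "Q \<in> ?X" for R Q
  proof -
    have "\<exists>n. near D n (L 0) (z0 * x)" for x using reach_mult L(2) by blast
    then have track: "\<exists>k. near D C (L k) (z0 * x)" "\<exists>k. near D C (z0 * x) (L k)" for x using C by blast+
    have "\<forall>j. \<exists>k. near D C (L k) (z0 * Q j)" "\<forall>i. \<exists>k. near D C (z0 * R i) (L k)"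
      using track by blast+
    then obtain \<kappa> l where \<kappa>: "\<And>j. near D C (L (\<kappa> j)) (z0 * Q j)"
      and l: "\<And>i. near D C (z0 * R i) (L (l i))" by metis
    have inj: "inj (\<lambda>i. z0 * P i)" if "P \<in> ?X" for P
      using qg_sequence_inj[OF that] left_cancel by (auto simp: inj_def)
    have step: "\<kappa> (Suc j) \<le> \<kappa> j + K2" for j
    proof (rule ccontr)
      assume "\<not> ?thesis"
      then have less: "\<kappa> j + K2 < \<kappa> (Suc j)" by simp
      have 1: "near D (\<kappa> (Suc j) - \<kappa> j) (L (\<kappa> j)) (L (\<kappa> (Suc j)))"
        using geodesic_segmentD[OF L(1) _ order_refl, of "\<kappa> j" "\<kappa> (Suc j)"] less by simp
      have "near D K1 (z0 * Q j) (z0 * Q (Suc j))"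
        using K1[OF near_edge[OF edges[OF Q]]] by (simp add: near_mult_left)
      from K2[OF near_trans[OF \<kappa> this] 1 \<kappa>] have "near D K2 (L (\<kappa> j)) (L (\<kappa> (Suc j)))" by blast
      then show False using geodesic_segmentD[OF L(1), of "\<kappa> j" "\<kappa> (Suc j)" "\<kappa> (Suc j)" K2] less by simp
    qed
    have unbounded: "\<exists>N. m \<le> \<kappa> N" for m
    proof (rule ccontr)
      assume "\<not> ?thesis"
      then have "(\<lambda>j. z0 * Q j) ` UNIV \<subseteq> (\<Union>k<m. {y. near D C (L k) y})"
        using \<kappa> by (auto simp: not_le)
      then have "finite (range (\<lambda>j. z0 * Q j))"
        by (rule finite_subset) (auto intro: finite_out_ball)
      then show False using inj[OF Q] finite_imageD infinite_UNIV_nat by blast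
    qed
    have "finite (\<Union>k<\<kappa> 0. {i. near D C (z0 * R i) (L k)})"
      using finite_near_initial[OF inj[OF R] finite_in_ball] by blast
    moreover have "- (\<Union>k<\<kappa> 0. {i. near D C (z0 * R i) (L k)}) \<subseteq>
        {i. \<exists>j. near D (C + K2 + C) (z0 * R i) (z0 * Q j)}"
    proof
      fix i assume "i \<in> - (\<Union>k<\<kappa> 0. {i. near D C (z0 * R i) (L k)})"
      then have "\<kappa> 0 \<le> l i" using l[of i] by (rule_tac ccontr) auto
      moreover obtain N where "l i \<le> \<kappa> N" using unbounded by blast
      ultimately obtain j where j: "l i \<le> \<kappa> j" "\<kappa> j \<le> l i + K2"
        using discrete_intermediate_value[of \<kappa> "l i" N K2] step by metis
      then have "near D K2 (L (l i)) (L (\<kappa> j))" using geodesic_segmentD[OF L(1) _ order_refl, of "l i" "\<kappa> j"] by simp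
      then have "near D (C + K2 + C) (z0 * R i) (z0 * Q j)" using l \<kappa> near_trans by metis
      then show "i \<in> {i. \<exists>j. near D (C + K2 + C) (z0 * R i) (z0 * Q j)}" by blast
    qed
    ultimately have "infinite {i. \<exists>j. near D (C + K2 + C) (z0 * R i) (z0 * Q j)}"
      by (metis finite_compl finite_subset infinite_UNIV_nat)
    then have "coarse_le D (\<lambda>i. z0 * R i) (\<lambda>i. z0 * Q i)" unfolding coarse_le_def by blast
    then show ?thesis by (simp add: coarse_le_mult_left)
  qed
  then have "ray_equiv (cayley_digraph A) `` {R} = ?X" if "R \<in> ?X" for R
    using that unfolding Image_singleton A.ray_equiv_iff coarse_le_A_iff by blast
  then show ?thesis unfolding A.qg_boundary_eq quotient_def by blast
qed

end

section \<open>The group case\<close>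

definition geodesic_line :: "'a rel \<Rightarrow> (int \<Rightarrow> 'a) \<Rightarrow> bool" where
  "geodesic_line E L \<longleftrightarrow> (\<forall>i j m. i \<le> j \<longrightarrow> (near E m (L i) (L j) \<longleftrightarrow> j - i \<le> int m))"

lemma geodesic_lineD:
  "geodesic_line E L \<Longrightarrow> i \<le> j \<Longrightarrow> near E m (L i) (L j) \<longleftrightarrow> j - i \<le> int m"
  unfolding geodesic_line_def by blast

lemma geodesic_line_segment:
  assumes "geodesic_line E L"
  shows "geodesic_segment E (\<lambda>i. L (int i - a)) n"
  unfolding geodesic_segment_def using geodesic_lineD[OF assms] by auto

text \<open>A group is transitive on its Cayley digraph; sliding longer and longer segments of a geodesic
  ray so that their midpoints sit at the identity, they converge to a line.\<close>

lemma (in fg_cancellative) group_has_geodesic_line: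
  assumes e: "\<And>x. e * x = x" and inverse: "\<And>x :: 'a. i x * x = e"
    and inf: "infinite (UNIV :: 'a set)"
  obtains L where "geodesic_line D L"
proof -
  have "\<exists>n. near D n e z" for z using reach_mult[of e z] by (simp add: e)
  with geodesic_ray_towards[OF finite_out_ball inf, of e]
  obtain G where G: "\<And>n. geodesic_segment D G n" by metis
  \<comment> \<open>The stretch of \<open>G\<close> from \<open>G 0\<close> to \<open>G (2 * n)\<close>, translated such that its midpoint becomes \<open>e\<close>.\<close>
  define g where "g n k = i (G n) * G (nat (int n + k))" for n k
  have g0: "g n 0 = e" for n by (simp add: g_def inverse)
  have g: "near D m (g n j) (g n k) \<longleftrightarrow> k - j \<le> int m" if "- int n \<le> j" "j \<le> k" for n j k m
    unfolding g_def near_mult_left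
    using geodesic_segmentD[OF G _ order_refl, of "nat (int n + j)" "nat (int n + k)" m] that by auto
  define f where "f n k = (if k \<le> n then (g n (int k), g n (- int k)) else (e, e))" for n k
  have "range (\<lambda>n. f n k) \<subseteq> {y. near D k e y} \<times> {y. near D k y e}" for k
  proof (rule image_subsetI)
    show "f n k \<in> {y. near D k e y} \<times> {y. near D k y e}" for n
      using g[of n 0 "int k" k] g[of n "- int k" 0 k] by (auto simp: f_def g0)
  qed
  then have "finite (range (\<lambda>n. f n k))" for k
    by (rule finite_subset) (intro finite_cartesian_product finite_out_ball finite_in_ball)
  then obtain h where h: "\<And>N. infinite {n \<in> UNIV. \<forall>k<N. f n k = h k}"
    using pointwise_subsequence_limit[of f UNIV] by blast
  define L where "L k = (if k \<ge> 0 then fst (h (nat k)) else snd (h (nat (- k))))" for k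
  have approx: "\<exists>n\<ge>N. \<forall>k. \<bar>k\<bar> \<le> int N \<longrightarrow> L k = g n k" for N
  proof -
    have "\<exists>n>N. n \<in> {n \<in> UNIV. \<forall>k<Suc N. f n k = h k}"
      using h[of "Suc N"] by (meson infinite_nat_iff_unbounded)
    then obtain n where n: "n > N" "\<And>k. k \<le> N \<Longrightarrow> h k = f n k" by (auto simp: less_Suc_eq_le)
    have "L k = g n k" if "\<bar>k\<bar> \<le> int N" for k
    proof -
      have "nat k \<le> N" "nat (- k) \<le> N" using that by auto
      with n show ?thesis by (auto simp: L_def f_def)
    qed
    with n(1) show ?thesis by (intro exI[of _ n]) auto
  qed
  have "geodesic_line D L"
    unfolding geodesic_line_def
  proof (intro allI impI)
    fix j k :: int and m assume "j \<le> k"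
    define N where "N = nat (max \<bar>j\<bar> \<bar>k\<bar>)"
    obtain n where n: "n \<ge> N" "\<And>k. \<bar>k\<bar> \<le> int N \<Longrightarrow> L k = g n k" using approx by blast
    have "\<bar>j\<bar> \<le> int N" "\<bar>k\<bar> \<le> int N" by (auto simp: N_def)
    then show "near D m (L j) (L k) \<longleftrightarrow> k - j \<le> int m"
      using g[of n j k m] n \<open>j \<le> k\<close> by simp
  qed
  with that show thesis .
qed

lemma (in fg_cancellative) group_distance_symmetric:
  assumes e: "\<And>x. x * e = x" and inverse: "\<And>x :: 'a. x * i x = e"
  obtains C where "\<And>n x y. near D n x y \<Longrightarrow> near D (C * n) y x"
proof -
  have "finite (i ` B)" using generating by (simp add: finite_generating_set_def)
  then obtain C where C: "\<And>x u. u \<in> i ` B \<Longrightarrow> near D C x (x * u)" using reach_uniform by metis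
  have edge: "near D C y x" if xy: "(x, y) \<in> D" for x y
  proof -
    from xy obtain b where b: "b \<in> B" "y = x * b" unfolding cayley_digraph_def by blast
    then have "near D C y (y * i b)" using C by blast
    then show ?thesis using b(2) by (simp add: mult.assoc inverse e)
  qed
  have "(x, y) \<in> D ^^ n \<Longrightarrow> near D (C * n) y x" for n x y
  proof (induction n arbitrary: y)
    case (Suc n)
    then obtain z where "(x, z) \<in> D ^^ n" "(z, y) \<in> D" by auto
    then have "near D C y z" "near D (C * n) z x" using Suc edge by auto
    from near_trans[OF this] show ?case by simp
  qed auto
  then have "near D (C * n) y x" if "near D n x y" for n x y
    using that near_mono mult_le_mono2 unfolding near_iff_relpow[of D n x y] by metis
  with that show thesis .
qed

text \<open>
  Both halves of a line are coarse rays away from its centre; for the half that is traversed against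
  the direction of its edges this uses that distances are symmetric up to a factor.
\<close>

lemma coarse_rays_of_line:
  assumes L: "geodesic_line E L" and sym: "\<And>n x y. near E n x y \<Longrightarrow> near E (C * n) y x"
  shows "coarse_ray E (\<lambda>n. L (int n))" "coarse_ray E (\<lambda>n. L (- int n))"
proof -
  show "coarse_ray E (\<lambda>n. L (int n))"
    using geodesic_ray_imp_coarse_ray[OF geodesic_line_segment[OF L, of 0]] by simp
  show "coarse_ray E (\<lambda>n. L (- int n))"
    unfolding coarse_ray_def
  proof (intro exI[of _ C] conjI allI impI)
    show "near E C (L (- int i)) (L (- int (Suc i)))" for i
      using sym[of 1 "L (- int (Suc i))" "L (- int i)"] geodesic_lineD[OF L, of "- int (Suc i)" "- int i" 1]
      by simp
    fix i j m assume "i \<le> j" "near E m (L (- int i)) (L (- int j))"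
    then have "near E (C * m) (L (- int j)) (L (- int i))" using sym by blast
    then have "int (j - i) \<le> int (C * m)"
      using geodesic_lineD[OF L, of "- int j" "- int i" "C * m"] \<open>i \<le> j\<close> by auto
    then show "j - i \<le> C * m + C" by linarith
  qed
qed

lemma geodesic_line_inj:
  assumes "geodesic_line E L"
  shows "inj L"
proof (rule linorder_injI)
  fix i j :: int assume "i < j"
  then show "L i \<noteq> L j" using geodesic_lineD[OF assms, of i j 0] by auto
qed

context finite_boundary_hyperbolic
begin

text \<open>
  A translate with the same two ends as the line: far out, on both sides, short geodesics join it to
  the line.  Thinness of the two triangles into which a diagonal divides this quadrilateral leads
  from the centre of the translate to the diagonal and on to the line.
\<close>

lemma translate_meets_line:
  assumes L: "geodesic_line D L" and sym: "\<And>n x y. near D n x y \<Longrightarrow> near D (C * n) y x"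
    and forward: "coarse_le D (\<lambda>n. s * L (int n)) (\<lambda>n. L (int n))"
    and backward: "coarse_le D (\<lambda>n. s * L (- int n)) (\<lambda>n. L (- int n))"
  shows "\<exists>k. near D (C * \<delta> + \<delta>) (s * L 0) (L k)"
proof -
  have inj: "inj (\<lambda>n. s * L (int n))" "inj (\<lambda>n. s * L (- int n))"
    using geodesic_line_inj[OF L] by (auto intro!: injI dest!: left_cancel injD)
  obtain M where M: "\<And>N. \<exists>j\<ge>N. \<exists>i. near D M (s * L (int j)) (L (int i))"
    using coarse_le_far_pairs[OF forward inj(1)] by (metis finite.emptyI)
  obtain M' where M': "\<And>N. \<exists>j\<ge>N. \<exists>i. near D M' (s * L (- int j)) (L (- int i))"
    using coarse_le_far_pairs[OF backward inj(2)] by (metis finite.emptyI)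
  obtain b d where b: "b \<ge> \<delta> + C * M + 1" "near D M (s * L (int b)) (L (int d))" using M by blast
  obtain a c where a: "a \<ge> M' + \<delta> + \<delta> + 1" "near D M' (s * L (- int a)) (L (- int c))" using M' by blast
  define f where "f i = s * L (int i - int a)" for i
  have f: "geodesic_segment D f n" for n
    using geodesic_line_segment[OF L, of "int a"] unfolding geodesic_segment_def f_def near_mult_left by blast
  have f_ends: "f 0 = s * L (- int a)" "f (a + b) = s * L (int b)" "f a = s * L 0" by (simp_all add: f_def)
  obtain S l where S: "l \<le> M" "geodesic_segment D S l" "S 0 = s * L (int b)" "S l = L (int d)"
    using geodesic_exists[OF b(2)] by metis
  obtain S' l' where S': "l' \<le> M'" "geodesic_segment D S' l'" "S' 0 = s * L (- int a)" "S' l' = L (- int c)"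
    using geodesic_exists[OF a(2)] by metis
  have "near D (a + b) (s * L (- int a)) (s * L (int b))"
    using geodesic_lineD[OF L, of "- int a" "int b" "a + b"] by (simp add: near_mult_left)
  from near_trans[OF this b(2)] obtain H n where H: "geodesic_segment D H n" "H 0 = s * L (- int a)" "H n = L (int d)"
    by (rule geodesic_exists)
  have "(\<exists>j\<le>n. near D \<delta> (H j) (f a)) \<or> (\<exists>j\<le>l. near D \<delta> (f a) (S j))"
    by (rule thin_sides(2)[OF f[of "a + b"] S(2) H(1)]) (auto simp: f_ends S H)
  moreover have False if j: "j \<le> l" "near D \<delta> (f a) (S j)" for j
  proof -
    have "near D M (f (a + b)) (S j)" using geodesic_segmentD[OF S(2), of 0 j M] S j f_ends by simp
    from near_trans[OF j(2) sym[OF this]] have "near D (\<delta> + C * M) (f a) (f (a + b))" .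
    then show False using geodesic_segmentD[OF f order_trans[OF _ order_refl] order_refl, of a "a + b"] b(1) by simp
  qed
  ultimately obtain i where i: "i \<le> n" "near D \<delta> (H i) (f a)" by blast
  have "(\<exists>j\<le>l'. near D \<delta> (S' j) (H i)) \<or> (\<exists>j\<le>c + d. near D \<delta> (H i) (L (int j - int c)))"
    by (rule thin_sides(1)[OF S'(2) geodesic_line_segment[OF L] H(1)]) (use S' H i in auto)
  moreover have False if j: "j \<le> l'" "near D \<delta> (S' j) (H i)" for j
  proof -
    have "near D M' (f 0) (S' j)" using geodesic_segmentD[OF S'(2), of 0 j M'] S' j f_ends by simp
    from near_trans[OF near_trans[OF this j(2)] i(2)] have "near D (M' + \<delta> + \<delta>) (f 0) (f a)" .
    then show False using geodesic_segmentD[OF f _ order_refl, of 0 a] a(1) by simp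
  qed
  ultimately obtain k where "near D \<delta> (H i) (L k)" by blast
  from near_trans[OF sym[OF i(2)] this] show ?thesis unfolding f_ends by blast
qed

text \<open>
  There are only finitely many types of pairs of ends for the translates of the line by inverses.  If
  \<open>i c\<close> and \<open>i f\<close> have the same type, then \<open>c * i f\<close> moves the line to a line with the same ends.  Taking
  types of the inverses makes \<open>c\<close> differ from \<open>c * i f\<close> by a factor on the right, and thus by a bounded
  distance.
\<close>

lemma group_near_line:
  assumes e: "\<And>x. e * x = x" "\<And>x. x * e = x"
    and inverse: "\<And>x :: 'a. i x * x = e" "\<And>x. x * i x = e"
    and L: "geodesic_line D L" and sym: "\<And>n x y. near D n x y \<Longrightarrow> near D (C * n) y x"
  obtains K where "\<And>c. \<exists>k. near D K c (L k)"
proof -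
  obtain \<kappa> :: "'a \<Rightarrow> (nat \<Rightarrow> 'a) set" where \<kappa>: "finite (range \<kappa>)"
    "\<And>s t. \<kappa> s = \<kappa> t \<Longrightarrow> coarse_le D (\<lambda>n. s * L (int n)) (\<lambda>n. t * L (int n))"
    using translate_types[OF coarse_rays_of_line(1)[OF L sym]] by blast
  obtain \<kappa>' :: "'a \<Rightarrow> (nat \<Rightarrow> 'a) set" where \<kappa>': "finite (range \<kappa>')"
    "\<And>s t. \<kappa>' s = \<kappa>' t \<Longrightarrow> coarse_le D (\<lambda>n. s * L (- int n)) (\<lambda>n. t * L (- int n))"
    using translate_types[OF coarse_rays_of_line(2)[OF L sym]] by blast
  define \<tau> where "\<tau> c = (\<kappa> (i c), \<kappa>' (i c))" for c
  have "range \<tau> \<subseteq> range \<kappa> \<times> range \<kappa>'" by (auto simp: \<tau>_def)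
  then have "finite (range \<tau>)" using \<kappa>(1) \<kappa>'(1) finite_subset by blast
  then have "finite ((\<lambda>t. i (inv \<tau> t) * L 0) ` range \<tau>)" by blast
  then obtain N where N: "\<And>x u. u \<in> (\<lambda>t. i (inv \<tau> t) * L 0) ` range \<tau> \<Longrightarrow> near D N x (x * u)"
    using reach_uniform by metis
  have "\<exists>k. near D (N + (C * \<delta> + \<delta>)) c (L k)" for c
  proof -
    define f where "f = inv \<tau> (\<tau> c)"
    have "\<tau> f = \<tau> c" unfolding f_def by (simp add: f_inv_into_f)
    then have eq: "\<kappa> (i f) = \<kappa> (i c)" "\<kappa>' (i f) = \<kappa>' (i c)" by (auto simp: \<tau>_def)
    have cancel: "c * (i c * x) = x" for x by (simp add: mult.assoc[symmetric] inverse e)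
    have "coarse_le D (\<lambda>n. c * (i f * L (int n))) (\<lambda>n. c * (i c * L (int n)))"
      unfolding coarse_le_mult_left by (rule \<kappa>(2)[OF eq(1)])
    then have 1: "coarse_le D (\<lambda>n. c * i f * L (int n)) (\<lambda>n. L (int n))"
      unfolding cancel by (simp add: mult.assoc)
    have "coarse_le D (\<lambda>n. c * (i f * L (- int n))) (\<lambda>n. c * (i c * L (- int n)))"
      unfolding coarse_le_mult_left by (rule \<kappa>'(2)[OF eq(2)])
    then have 2: "coarse_le D (\<lambda>n. c * i f * L (- int n)) (\<lambda>n. L (- int n))"
      unfolding cancel by (simp add: mult.assoc)
    obtain k where k: "near D (C * \<delta> + \<delta>) (c * i f * L 0) (L k)"
      using translate_meets_line[OF L sym 1 2] by blast
    have "near D N c (c * (i f * L 0))" by (rule N) (auto simp: f_def)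
    from near_trans[OF this k[unfolded mult.assoc]] show ?thesis by blast
  qed
  with that show thesis by blast
qed

end

section \<open>Sequences in a space that is coarsely a line\<close>

text \<open>
  Once the sequence has left the interval around \<open>0\<close> of radius \<open>K\<close> for good, it cannot jump over it.
\<close>

lemma one_sided_if_bounded_steps:
  fixes f :: "nat \<Rightarrow> int"
  assumes step: "\<And>i. \<bar>f (Suc i) - f i\<bar> \<le> int K" and fin: "\<And>N :: int. finite {i. \<bar>f i\<bar> \<le> N}"
  shows "filterlim f at_top sequentially \<or> filterlim f at_bot sequentially"
proof -
  have ev: "eventually (\<lambda>i. \<bar>f i\<bar> > N) sequentially" for N
    using fin[of N] unfolding cofinite_eq_sequentially[symmetric] eventually_cofinite by (simp add: not_less)
  obtain i0 where i0: "\<And>i. i \<ge> i0 \<Longrightarrow> \<bar>f i\<bar> > int K"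
    using ev[of "int K"] unfolding eventually_sequentially by blast
  show ?thesis
  proof (cases "f i0 > 0")
    case True
    have "f i > 0" if "i \<ge> i0" for i
      using that
    proof (induction i rule: dec_induct)
      case (step i)
      then show ?case using i0[of "Suc i"] i0[of i] assms(1)[of i] by linarith
    qed (use True in auto)
    then have pos: "eventually (\<lambda>i. f i > 0) sequentially" unfolding eventually_sequentially by blast
    have "filterlim f at_top sequentially"
      unfolding filterlim_at_top
    proof
      show "eventually (\<lambda>i. Z \<le> f i) sequentially" for Z
        using ev[of "Z"] pos by eventually_elim auto
    qed
    then show ?thesis ..
  next
    case False
    have "f i < 0" if "i \<ge> i0" for i
      using that
    proof (induction i rule: dec_induct)
      case base
      then show ?case using False i0[of i0] by auto
    next
      case (step i)
      then show ?case using i0[of "Suc i"] i0[of i] assms(1)[of i] by linarith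
    qed
    then have neg: "eventually (\<lambda>i. f i < 0) sequentially" unfolding eventually_sequentially by blast
    have "filterlim f at_bot sequentially"
      unfolding filterlim_at_bot
    proof
      show "eventually (\<lambda>i. f i \<le> Z) sequentially" for Z
        using ev[of "-Z"] neg by eventually_elim auto
    qed
    then show ?thesis ..
  qed
qed

text \<open>
  Here \<open>p\<close> is a coarse coordinate.  While \<open>p\<close> grows along \<open>Q\<close> with bounded steps, it comes close to every
  value that it takes far out on \<open>R\<close>.
\<close>

lemma coarse_le_same_end:
  fixes p :: "'a \<Rightarrow> int"
  assumes R: "filterlim (\<lambda>i. p (R i)) at_top sequentially"
    and Q: "filterlim (\<lambda>i. p (Q i)) at_top sequentially"
    and step: "\<And>j. \<bar>p (Q (Suc j)) - p (Q j)\<bar> \<le> int K"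
    and near: "\<And>x y. \<bar>p x - p y\<bar> \<le> int K \<Longrightarrow> near E M x y"
  shows "coarse_le E R Q"
proof -
  have "\<exists>j. near E M (R i) (Q j)" if i: "p (Q 0) + 1 \<le> p (R i)" for i
  proof -
    \<comment> \<open>Truncation does no harm, because \<open>m\<close> is positive.\<close>
    define f where "f j = nat (p (Q j) - p (Q 0))" for j
    define m where "m = nat (p (R i) - p (Q 0))"
    have "eventually (\<lambda>j. p (R i) \<le> p (Q j)) sequentially" using Q unfolding filterlim_at_top by blast
    then obtain N where "p (R i) \<le> p (Q N)" using eventually_happens' by (metis sequentially_bot)
    then have "m \<le> f N" by (auto simp: m_def f_def)
    moreover have "f (Suc j) \<le> f j + K" for j using step[of j] unfolding f_def by linarith
    ultimately obtain j where "m \<le> f j" "f j \<le> m + K"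
      using discrete_intermediate_value[of f m N K] by (auto simp: f_def)
    moreover have "p (R i) = p (Q 0) + int m" "m > 0" using i by (simp_all add: m_def)
    ultimately have "\<bar>p (R i) - p (Q j)\<bar> \<le> int K" unfolding f_def by linarith
    then show ?thesis using near by blast
  qed
  moreover have "eventually (\<lambda>i. p (Q 0) + 1 \<le> p (R i)) sequentially" using R unfolding filterlim_at_top by blast
  ultimately have "eventually (\<lambda>i. \<exists>j. near E M (R i) (Q j)) sequentially"
    by (auto elim: eventually_mono)
  then have "infinite {i. \<exists>j. near E M (R i) (Q j)}"
    unfolding frequently_cofinite[symmetric] cofinite_eq_sequentially
    by (rule eventually_frequently[OF sequentially_bot])
  then show ?thesis unfolding coarse_le_def by blast
qed

lemma not_coarse_le_opposite_end:
  fixes p :: "'a \<Rightarrow> int"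
  assumes R: "filterlim (\<lambda>i. p (R i)) at_top sequentially"
    and Q: "filterlim (\<lambda>i. p (Q i)) at_bot sequentially"
    and lip: "\<And>n x y. near E n x y \<Longrightarrow> \<bar>p x - p y\<bar> \<le> int (\<Lambda> n)"
  shows "\<not> coarse_le E R Q"
proof
  assume "coarse_le E R Q"
  then obtain M where M: "infinite {i. \<exists>j. near E M (R i) (Q j)}" unfolding coarse_le_def by blast
  obtain N where N: "\<And>j. j \<ge> N \<Longrightarrow> p (Q j) \<le> 0"
    using Q unfolding filterlim_at_bot eventually_sequentially by blast
  define b where "b = Max (insert 0 ((\<lambda>j. p (Q j)) ` {..N}))"
  have b: "p (Q j) \<le> b" for j
  proof (cases "j \<le> N")
    case True
    then show ?thesis unfolding b_def by (intro Max_ge) auto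
  next
    case False
    then have "p (Q j) \<le> 0" using N by simp
    also have "0 \<le> b" unfolding b_def by simp
    finally show ?thesis .
  qed
  have "eventually (\<lambda>i. b + int (\<Lambda> M) + 1 \<le> p (R i)) sequentially"
    using R unfolding filterlim_at_top by blast
  then have "eventually (\<lambda>i. \<not> (\<exists>j. near E M (R i) (Q j))) sequentially"
  proof (rule eventually_mono)
    fix i assume i: "b + int (\<Lambda> M) + 1 \<le> p (R i)"
    show "\<not> (\<exists>j. near E M (R i) (Q j))"
    proof
      assume "\<exists>j. near E M (R i) (Q j)"
      then obtain j where "near E M (R i) (Q j)" by blast
      from lip[OF this] b[of j] i show False by linarith
    qed
  qed
  then have "finite {i. \<exists>j. near E M (R i) (Q j)}"
    unfolding cofinite_eq_sequentially[symmetric] eventually_cofinite by simp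
  with M show False ..
qed

section \<open>The number of boundary points\<close>

context finite_boundary_hyperbolic
begin

text \<open>
  The position of a nearby point of the line is a coarse coordinate on the group.  Along a
  quasi-geodesic ray or anti-ray it tends to one of the two infinities, and this determines the class.
\<close>

lemma group_boundary_two_classes:
  assumes e: "\<And>x. e * x = x" "\<And>x. x * e = x"
    and i: "\<And>x :: 'a. i x * x = e" "\<And>x. x * i x = e"
    and inf: "infinite (UNIV :: 'a set)"
  obtains X Y where "qg_boundary (cayley_digraph A) \<subseteq> {X, Y}"
proof -
  let ?X = "qg_sequences (cayley_digraph A)"
  obtain L where L: "geodesic_line D L" using group_has_geodesic_line[OF e(1) i(1) inf] by blast
  obtain C where C: "\<And>n x y. near D n x y \<Longrightarrow> near D (C * n) y x"
    using group_distance_symmetric[OF e(2) i(2)] by blast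
  obtain K where "\<And>c. \<exists>k. near D K c (L k)" using group_near_line[OF e i L C] by blast
  then obtain p where p: "\<And>c. near D K c (L (p c))" by metis
  define \<Lambda> where "\<Lambda> n = C * K + n + C * n + K" for n
  have lip: "\<bar>p x - p y\<bar> \<le> int (\<Lambda> n)" if "near D n x y" for n x y
  proof (cases "p x \<le> p y")
    case True
    have "near D (C * K + n + K) (L (p x)) (L (p y))"
      by (rule near_trans[OF near_trans[OF C[OF p] that] p])
    then have "p y - p x \<le> int (C * K + n + K)" using geodesic_lineD[OF L True] by blast
    with True show ?thesis unfolding \<Lambda>_def by linarith
  next
    case False
    have "near D (C * K + C * n + K) (L (p y)) (L (p x))"
      by (rule near_trans[OF near_trans[OF C[OF p] C[OF that]] p])
    then have "p x - p y \<le> int (C * K + C * n + K)" using geodesic_lineD[OF L, of "p y" "p x"] False by simp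
    with False show ?thesis unfolding \<Lambda>_def by linarith
  qed
  have near: "near D (K + (n + C * n) + C * K) x y" if "\<bar>p x - p y\<bar> \<le> int n" for n x y
  proof -
    have "near D (n + C * n) (L (p x)) (L (p y))"
    proof (cases "p x \<le> p y")
      case True
      then show ?thesis using geodesic_lineD[OF L True, of "n + C * n"] that by linarith
    next
      case False
      then have "near D n (L (p y)) (L (p x))" using geodesic_lineD[OF L, of "p y" "p x" n] that by linarith
      from near_mono[OF C[OF this]] show ?thesis by simp
    qed
    from near_trans[OF near_trans[OF p this] C[OF p]] show ?thesis .
  qed
  obtain K1 where K1: "\<And>n x y. near (cayley_digraph A) n x y \<Longrightarrow> near D (K1 * n) x y"
    using near_from_A by blast
  have step: "\<bar>p (R (Suc j)) - p (R j)\<bar> \<le> int (\<Lambda> K1)" if "R \<in> ?X" for R j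
  proof -
    have "near D K1 (R j) (R (Suc j)) \<or> near D K1 (R (Suc j)) (R j)"
      using qg_sequence_edges[OF that] K1[OF near_edge] by fastforce
    then show ?thesis using lip by (metis abs_minus_commute)
  qed
  let ?up = "\<lambda>R. filterlim (\<lambda>j. p (R j)) at_top sequentially"
  let ?down = "\<lambda>R. filterlim (\<lambda>j. p (R j)) at_bot sequentially"
  have ends: "?up R \<or> ?down R" if R: "R \<in> ?X" for R
  proof (rule one_sided_if_bounded_steps[of "\<lambda>j. p (R j)", OF step[OF R]])
    fix N :: int
    have "finite (\<Union>k\<in>{-N..N}. {j. near D K (R j) (L k)})"
      using finite_near_initial[OF qg_sequence_inj[OF R] finite_in_ball] by blast
    moreover have "{j. \<bar>p (R j)\<bar> \<le> N} \<subseteq> (\<Union>k\<in>{-N..N}. {j. near D K (R j) (L k)})"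
    proof
      fix j assume "j \<in> {j. \<bar>p (R j)\<bar> \<le> N}"
      then show "j \<in> (\<Union>k\<in>{-N..N}. {j. near D K (R j) (L k)})"
        using p[of "R j"] by (intro UN_I[of "p (R j)"]) auto
    qed
    ultimately show "finite {j. \<bar>p (R j)\<bar> \<le> N}" by (rule finite_subset[rotated])
  qed
  have up_up: "coarse_le D R Q" if "?up R" "?up Q" "Q \<in> ?X" for R Q
    using coarse_le_same_end[OF that(1,2) step[OF that(3)] near] by blast
  have uminus: "filterlim (\<lambda>j. - p (P j)) at_top sequentially" if "?down P" for P
    unfolding filterlim_at_top
  proof
    fix Z
    have "eventually (\<lambda>j. p (P j) \<le> - Z) sequentially" using that unfolding filterlim_at_bot by blast
    then show "eventually (\<lambda>j. Z \<le> - p (P j)) sequentially" by (rule eventually_mono) auto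
  qed
  have down_down: "coarse_le D R Q" if "?down R" "?down Q" "Q \<in> ?X" for R Q
  proof (rule coarse_le_same_end[where p = "\<lambda>x. - p x"])
    show "filterlim (\<lambda>j. - p (R j)) at_top sequentially" "filterlim (\<lambda>j. - p (Q j)) at_top sequentially"
      using that(1,2) by (simp_all add: uminus)
    show "\<bar>- p (Q (Suc j)) - - p (Q j)\<bar> \<le> int (\<Lambda> K1)" for j using step[OF that(3), of j] by linarith
    show "near D (K + (\<Lambda> K1 + C * \<Lambda> K1) + C * K) x y" if "\<bar>- p x - - p y\<bar> \<le> int (\<Lambda> K1)" for x y
      using near[of x y "\<Lambda> K1"] that by linarith
  qed
  have up_down: "\<not> coarse_le D R Q" if "?up R" "?down Q" for R Q
    by (rule not_coarse_le_opposite_end[OF that lip])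
  have "ray_equiv (cayley_digraph A) `` {R} \<in> {{R \<in> ?X. ?up R}, {R \<in> ?X. ?down R}}" if "R \<in> ?X" for R
  proof (cases "?up R")
    case True
    then have "ray_equiv (cayley_digraph A) `` {R} = {R \<in> ?X. ?up R}"
      using that ends up_up up_down unfolding Image_singleton A.ray_equiv_iff coarse_le_A_iff by blast
    then show ?thesis by blast
  next
    case False
    then have "?down R" using ends[OF that] by blast
    then have "ray_equiv (cayley_digraph A) `` {R} = {R \<in> ?X. ?down R}"
      using that ends down_down up_down unfolding Image_singleton A.ray_equiv_iff coarse_le_A_iff by blast
    then show ?thesis by blast
  qed
  then have "qg_boundary (cayley_digraph A) \<subseteq> {{R \<in> ?X. ?up R}, {R \<in> ?X. ?down R}}"
    unfolding A.qg_boundary_eq quotient_def by blast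
  with that show thesis by blast
qed

lemma boundary_card_le_2: "card (qg_boundary (cayley_digraph A)) \<le> 2"
proof (cases "finite (UNIV :: 'a set)")
  case True
  have "qg_sequences (cayley_digraph A) = {}"
    using qg_sequence_inj True finite_imageD finite_subset infinite_UNIV_nat
    by (metis equals0I subset_UNIV)
  then show ?thesis by (simp add: A.qg_boundary_eq quotient_def)
next
  case inf: False
  show ?thesis
  proof (cases "\<forall>f :: 'a. finite {z. \<exists>h. z * h = f}")
    case True
    then have "qg_boundary (cayley_digraph A) \<subseteq> {qg_sequences (cayley_digraph A)}"
      using boundary_trivial_if_finitely_many_left_divisors inf by blast
    from card_mono[OF _ this] show ?thesis by simp
  next
    case False
    then obtain f :: 'a where "infinite {z. \<exists>h. z * h = f}" by blast
    then obtain e i where group: "\<And>x :: 'a. e * x = x" "\<And>x. x * e = x" "\<And>x. i x * x = e" "\<And>x. x * i x = e"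
      by (rule group_if_infinitely_many_left_divisors) (rule that)
    obtain X Y where XY: "qg_boundary (cayley_digraph A) \<subseteq> {X, Y}"
      by (rule group_boundary_two_classes[OF group inf]) (rule that)
    have "card {X, Y} \<le> 2" by (simp add: card_insert_if)
    with card_mono[OF _ XY] show ?thesis by simp
  qed
qed

end

theorem corollary11p2:
  fixes A :: "'a::semigroup_mult set"
  assumes left_cancel: "\<And>a b c :: 'a. a * b = a * c \<Longrightarrow> b = c"
    and right_cancel: "\<And>a b c :: 'a. b * a = c * a \<Longrightarrow> b = c"
    and hyperbolic: "hyperbolic_semigroup TYPE('a)"
    and generating: "finite_generating_set A"
    and T1: "t1_space (subtopology (forward_topology (cayley_digraph A))
                 (Inr ` qg_boundary (cayley_digraph A)))
           \<or> t1_space (subtopology (backward_topology (cayley_digraph A))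
                 (Inr ` qg_boundary (cayley_digraph A)))"
  shows "infinite (qg_boundary (cayley_digraph A)) \<or>
         card (qg_boundary (cayley_digraph A)) \<in> {0, 1, 2}"
proof (cases "finite (qg_boundary (cayley_digraph A))")
  case True
  from hyperbolic obtain B :: "'a set" where B: "finite_generating_set B"
    "hyperbolic_digraph (cayley_digraph B)" unfolding hyperbolic_semigroup_def by blast
  obtain \<delta> where \<delta>: "thin_transitive (cayley_digraph B) \<delta>"
    using hyperbolic_imp_thin_transitive[OF B(2)] by blast
  interpret finite_boundary_hyperbolic B A \<delta>
    using left_cancel right_cancel B(1) generating True \<delta> by unfold_locales
  have "card (qg_boundary (cayley_digraph A)) = 0 \<or> card (qg_boundary (cayley_digraph A)) = 1 \<or>
      card (qg_boundary (cayley_digraph A)) = 2" using boundary_card_le_2 by linarith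
  then show ?thesis by blast
qed simp

end
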